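(* Let $P : \mathbf{E} \to \mathbf{B}$ be a (cloven) fibration, let $I, J_1, \dots, J_n$ be objects of $\mathbf{B}$, let $F : \mathbf{P}_I \to \mathbf{P}_{J_1} \times \dots \times \mathbf{P}_{J_n}$ be a functor, and let $u = (u_1,\dots,u_n)$ be a family of morphisms $u_k : J_k \to I$ in $\mathbf{B}$. Write $F_k = \pi_k \circ F : \mathbf{P}_I \to \mathbf{P}_{J_k}$ for the $k$-th component of $F$, and $G_u = \langle u_1^*,\dots,u_n^*\rangle : \mathbf{P}_I \to \mathbf{P}_{J_1} \times \dots \times \mathbf{P}_{J_n}$. (1) If $P$ has fibrewise coproducts and dependent sums, then there is an isomorphism of categories $$\mathrm{DiAlg}(F, G_u) \cong \mathrm{Alg}\Big(\coprod_{u_1} \circ F_1 +_I \dots +_I \coprod_{u_n} \circ F_n\Big).$$ In particular, an inductive data type for $(F,u)$ (an initial $(F,G_u)$-dialgebra) exists if and only if an initial algebra for the endofunctor $\coprod_{u_1} \circ F_1 +_I \dots +_I \coprod_{u_n} \circ F_n$ of $\mathbf{P}_I$ exists. (2) Dually, if $P$ has fibrewise products and dependent products, then there is an isomorphism of categories $$\mathrm{DiAlg}(G_u, F) \cong \mathrm{CoAlg}\Big(\prod_{u_1} \circ F_1 \times_I \dots \times_I \prod_{u_n} \circ F_n\Big).$$ In particular, a coinductive data type for $(F,u)$ (a final $(G_u,F)$-dialgebra) exists if and only if a final coalgebra for the endofunctor $\prod_{u_1} \circ F_1 \times_I \dots \times_I \prod_{u_n} \circ F_n$ of $\mathbf{P}_I$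 exists.
   Context: All fibrations $P : \mathbf{E} \to \mathbf{B}$ are cloven (with chosen cartesian liftings). $\mathbf{P}_I$ denotes the fibre above $I \in \mathbf{B}$ (objects $A$ with $P(A) = I$, morphisms $f$ with $P(f) = \mathrm{id}_I$), and for $u : I \to J$ in $\mathbf{B}$, $u^* : \mathbf{P}_J \to \mathbf{P}_I$ is the reindexing functor. For functors $F, G : \mathbf{X} \to \mathbf{Y}$, an $(F,G)$-dialgebra is a pair $(A,c)$ with $A \in \mathbf{X}$ and $c : FA \to GA$ in $\mathbf{Y}$; a homomorphism $(A,c) \to (B,d)$ is a morphism $h : A \to B$ in $\mathbf{X}$ with $Gh \circ c = d \circ Fh$. $\mathrm{DiAlg}(F,G)$ is the category of $(F,G)$-dialgebras and homomorphisms. For an endofunctor $T$, $\mathrm{Alg}(T)$ and $\mathrm{CoAlg}(T)$ are the usual categories of $T$-algebras and $T$-coalgebras. $P$ has dependent sums (coproducts), respectively dependent products, if for each $f : I \to J$ in $\mathbf{B}$ the functor $f^* : \mathbf{P}_J \to \mathbf{P}_I$ has a left adjoint $\coprod_f : \mathbf{P}_I \to \mathbf{P}_J$, respectively a right adjoint $\prod_f : \mathbf{P}_I \to \mathbf{P}_J$. Fibrewise coproducts $+_I$ (products $\times_I$) are finite coproducts (products) in each fibre $\mathbf{P}_I$. *)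

theory Defs
  imports "HOL-Library.FuncSet"
begin

section \<open>Categories and functors\<close>

record ('o, 'a) category =
  Obj :: "'o set"
  Arr :: "'a set"
  Dom :: "'a \<Rightarrow> 'o"
  Cod :: "'a \<Rightarrow> 'o"
  Ide :: "'o \<Rightarrow> 'a"
  Comp :: "'a \<Rightarrow> 'a \<Rightarrow> 'a"

text \<open>Composition is written in the usual order: \<open>g \<cdot>\<^bsub>C\<^esub> f\<close> is ``\<open>g\<close> after \<open>f\<close>''. All operations
  are total HOL functions, but only their values on composable arrows of \<open>C\<close> matter.\<close>

abbreviation comp_in :: "'a \<Rightarrow> ('o, 'a) category \<Rightarrow> 'a \<Rightarrow> 'a"
  ("(_ \<cdot>\<^bsub>_\<^esub>/ _)" [56, 0, 55] 55) where
  "g \<cdot>\<^bsub>C\<^esub> f \<equiv> Comp C g f"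

definition hom :: "('o, 'a) category \<Rightarrow> 'o \<Rightarrow> 'o \<Rightarrow> 'a set" where
  "hom C A B = {f \<in> Arr C. Dom C f = A \<and> Cod C f = B}"

definition is_category :: "('o, 'a) category \<Rightarrow> bool" where
  "is_category C \<longleftrightarrow>
     (\<forall>f\<in>Arr C. Dom C f \<in> Obj C \<and> Cod C f \<in> Obj C) \<and>
     (\<forall>A\<in>Obj C. Ide C A \<in> hom C A A) \<and>
     (\<forall>f\<in>Arr C. \<forall>g\<in>Arr C. Dom C g = Cod C f \<longrightarrow>
        g \<cdot>\<^bsub>C\<^esub> f \<in> hom C (Dom C f) (Cod C g)) \<and>
     (\<forall>f\<in>Arr C. f \<cdot>\<^bsub>C\<^esub> Ide C (Dom C f) = f \<and> Ide C (Cod C f) \<cdot>\<^bsub>C\<^esub> f = f) \<and>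
     (\<forall>f\<in>Arr C. \<forall>g\<in>Arr C. \<forall>h\<in>Arr C. Dom C g = Cod C f \<and> Dom C h = Cod C g \<longrightarrow>
        (h \<cdot>\<^bsub>C\<^esub> g) \<cdot>\<^bsub>C\<^esub> f = h \<cdot>\<^bsub>C\<^esub> (g \<cdot>\<^bsub>C\<^esub> f))"

record ('o1, 'a1, 'o2, 'a2) func =
  FObj :: "'o1 \<Rightarrow> 'o2"
  FArr :: "'a1 \<Rightarrow> 'a2"

definition is_functor ::
  "('o1, 'a1) category \<Rightarrow> ('o2, 'a2) category \<Rightarrow> ('o1, 'a1, 'o2, 'a2) func \<Rightarrow> bool" where
  "is_functor C D F \<longleftrightarrow> is_category C \<and> is_category D \<and>
     (\<forall>A\<in>Obj C. FObj F A \<in> Obj D) \<and>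
     (\<forall>f\<in>Arr C. FArr F f \<in> hom D (FObj F (Dom C f)) (FObj F (Cod C f))) \<and>
     (\<forall>A\<in>Obj C. FArr F (Ide C A) = Ide D (FObj F A)) \<and>
     (\<forall>f\<in>Arr C. \<forall>g\<in>Arr C. Dom C g = Cod C f \<longrightarrow>
        FArr F (g \<cdot>\<^bsub>C\<^esub> f) = FArr F g \<cdot>\<^bsub>D\<^esub> FArr F f)"

definition id_func :: "('o, 'a, 'o, 'a) func" where
  "id_func = \<lparr>FObj = \<lambda>A. A, FArr = \<lambda>f. f\<rparr>"

definition comp_func ::
  "('o2, 'a2, 'o3, 'a3) func \<Rightarrow> ('o1, 'a1, 'o2, 'a2) func \<Rightarrow> ('o1, 'a1, 'o3, 'a3) func"
  (infixr "\<circ>\<^sub>F" 75) where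
  "G \<circ>\<^sub>F F = \<lparr>FObj = \<lambda>A. FObj G (FObj F A), FArr = \<lambda>f. FArr G (FArr F f)\<rparr>"

text \<open>Since functors are total HOL functions, two functors on \<open>C\<close> are equal when they agree on the
  objects and arrows of \<open>C\<close>.\<close>

definition func_eq ::
  "('o1, 'a1) category \<Rightarrow> ('o1, 'a1, 'o2, 'a2) func \<Rightarrow> ('o1, 'a1, 'o2, 'a2) func \<Rightarrow> bool" where
  "func_eq C F G \<longleftrightarrow>
     (\<forall>A\<in>Obj C. FObj F A = FObj G A) \<and> (\<forall>f\<in>Arr C. FArr F f = FArr G f)"

definition isomorphic_categories ::
  "('o1, 'a1) category \<Rightarrow> ('o2, 'a2) category \<Rightarrow> bool" where
  "isomorphic_categories C D \<longleftrightarrow>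
     (\<exists>F G. is_functor C D F \<and> is_functor D C G \<and>
        func_eq C (G \<circ>\<^sub>F F) id_func \<and> func_eq D (F \<circ>\<^sub>F G) id_func)"

definition is_initial :: "('o, 'a) category \<Rightarrow> 'o \<Rightarrow> bool" where
  "is_initial C X \<longleftrightarrow> X \<in> Obj C \<and> (\<forall>Y\<in>Obj C. \<exists>!f. f \<in> hom C X Y)"

definition is_final :: "('o, 'a) category \<Rightarrow> 'o \<Rightarrow> bool" where
  "is_final C X \<longleftrightarrow> X \<in> Obj C \<and> (\<forall>Y\<in>Obj C. \<exists>!f. f \<in> hom C Y X)"

definition adjunction ::
  "('o1, 'a1) category \<Rightarrow> ('o2, 'a2) category \<Rightarrow>
   ('o1, 'a1, 'o2, 'a2) func \<Rightarrow> ('o2, 'a2, 'o1, 'a1) func \<Rightarrow> bool" where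
  "adjunction C D L R \<longleftrightarrow> is_functor C D L \<and> is_functor D C R \<and>
     (\<exists>\<phi>. (\<forall>A\<in>Obj C. \<forall>B\<in>Obj D.
              bij_betw (\<phi> A B) (hom D (FObj L A) B) (hom C A (FObj R B))) \<and>
          (\<forall>A\<in>Obj C. \<forall>A'\<in>Obj C. \<forall>B\<in>Obj D. \<forall>B'\<in>Obj D.
             \<forall>a\<in>hom C A' A. \<forall>b\<in>hom D B B'. \<forall>f\<in>hom D (FObj L A) B.
               \<phi> A' B' ((b \<cdot>\<^bsub>D\<^esub> f) \<cdot>\<^bsub>D\<^esub> FArr L a) = (FArr R b \<cdot>\<^bsub>C\<^esub> \<phi> A B f) \<cdot>\<^bsub>C\<^esub> a))"


section \<open>Products of categories\<close>

text \<open>The product of a family of categories. Objects and arrows are extensional families, so that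
  each tuple is represented by exactly one function.\<close>

definition prod_cat ::
  "'k set \<Rightarrow> ('k \<Rightarrow> ('o, 'a) category) \<Rightarrow> ('k \<Rightarrow> 'o, 'k \<Rightarrow> 'a) category" where
  "prod_cat K C =
     \<lparr>Obj = (\<Pi>\<^sub>E k\<in>K. Obj (C k)),
      Arr = (\<Pi>\<^sub>E k\<in>K. Arr (C k)),
      Dom = \<lambda>f. \<lambda>k\<in>K. Dom (C k) (f k),
      Cod = \<lambda>f. \<lambda>k\<in>K. Cod (C k) (f k),
      Ide = \<lambda>A. \<lambda>k\<in>K. Ide (C k) (A k),
      Comp = \<lambda>g f. \<lambda>k\<in>K. g k \<cdot>\<^bsub>C k\<^esub> f k\<rparr>"

definition proj_func :: "'k \<Rightarrow> ('k \<Rightarrow> 'o, 'k \<Rightarrow> 'a, 'o, 'a) func" where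
  "proj_func k = \<lparr>FObj = \<lambda>A. A k, FArr = \<lambda>f. f k\<rparr>"

definition tuple_func ::
  "'k set \<Rightarrow> ('k \<Rightarrow> ('o1, 'a1, 'o2, 'a2) func) \<Rightarrow> ('o1, 'a1, 'k \<Rightarrow> 'o2, 'k \<Rightarrow> 'a2) func" where
  "tuple_func K G =
     \<lparr>FObj = \<lambda>A. \<lambda>k\<in>K. FObj (G k) A, FArr = \<lambda>f. \<lambda>k\<in>K. FArr (G k) f\<rparr>"


section \<open>Coproducts and products in a category\<close>

record ('k, 'o, 'a) cone =
  apex :: 'o
  leg :: "'k \<Rightarrow> 'a"

definition is_coproduct ::
  "('o, 'a) category \<Rightarrow> 'k set \<Rightarrow> ('k \<Rightarrow> 'o) \<Rightarrow> ('k, 'o, 'a) cone \<Rightarrow> bool" where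
  "is_coproduct C K A X \<longleftrightarrow>
     apex X \<in> Obj C \<and> (\<forall>k\<in>K. leg X k \<in> hom C (A k) (apex X)) \<and>
     (\<forall>Y\<in>Obj C. \<forall>f. (\<forall>k\<in>K. f k \<in> hom C (A k) Y) \<longrightarrow>
        (\<exists>!h. h \<in> hom C (apex X) Y \<and> (\<forall>k\<in>K. h \<cdot>\<^bsub>C\<^esub> leg X k = f k)))"

definition is_product ::
  "('o, 'a) category \<Rightarrow> 'k set \<Rightarrow> ('k \<Rightarrow> 'o) \<Rightarrow> ('k, 'o, 'a) cone \<Rightarrow> bool" where
  "is_product C K A X \<longleftrightarrow>
     apex X \<in> Obj C \<and> (\<forall>k\<in>K. leg X k \<in> hom C (apex X) (A k)) \<and>
     (\<forall>Y\<in>Obj C. \<forall>f. (\<forall>k\<in>K. f k \<in> hom C Y (A k)) \<longrightarrow>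
        (\<exists>!h. h \<in> hom C Y (apex X) \<and> (\<forall>k\<in>K. leg X k \<cdot>\<^bsub>C\<^esub> h = f k)))"

text \<open>The pointwise coproduct \<open>A \<mapsto> H\<^sub>1 A + \<dots> + H\<^sub>n A\<close> of functors \<open>H\<^sub>k : X \<rightarrow> C\<close>, formed with a choice
  \<open>cop\<close> of a coproduct cocone for each family of objects of \<open>C\<close>; dually for products. On arrows
  these are the induced mediating morphisms.\<close>

definition coproduct_func ::
  "('o1, 'a1) category \<Rightarrow> ('o2, 'a2) category \<Rightarrow> 'k set \<Rightarrow>
   (('k \<Rightarrow> 'o2) \<Rightarrow> ('k, 'o2, 'a2) cone) \<Rightarrow>
   ('k \<Rightarrow> ('o1, 'a1, 'o2, 'a2) func) \<Rightarrow> ('o1, 'a1, 'o2, 'a2) func" where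
  "coproduct_func X C K cop H =
     (let c = \<lambda>A. cop (\<lambda>k\<in>K. FObj (H k) A) in
      \<lparr>FObj = \<lambda>A. apex (c A),
       FArr = \<lambda>f. THE h. h \<in> hom C (apex (c (Dom X f))) (apex (c (Cod X f))) \<and>
          (\<forall>k\<in>K. h \<cdot>\<^bsub>C\<^esub> leg (c (Dom X f)) k = leg (c (Cod X f)) k \<cdot>\<^bsub>C\<^esub> FArr (H k) f)\<rparr>)"

definition product_func ::
  "('o1, 'a1) category \<Rightarrow> ('o2, 'a2) category \<Rightarrow> 'k set \<Rightarrow>
   (('k \<Rightarrow> 'o2) \<Rightarrow> ('k, 'o2, 'a2) cone) \<Rightarrow>
   ('k \<Rightarrow> ('o1, 'a1, 'o2, 'a2) func) \<Rightarrow> ('o1, 'a1, 'o2, 'a2) func" where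
  "product_func X C K prd H =
     (let c = \<lambda>A. prd (\<lambda>k\<in>K. FObj (H k) A) in
      \<lparr>FObj = \<lambda>A. apex (c A),
       FArr = \<lambda>f. THE h. h \<in> hom C (apex (c (Dom X f))) (apex (c (Cod X f))) \<and>
          (\<forall>k\<in>K. leg (c (Cod X f)) k \<cdot>\<^bsub>C\<^esub> h = FArr (H k) f \<cdot>\<^bsub>C\<^esub> leg (c (Dom X f)) k)\<rparr>)"


section \<open>Dialgebras\<close>

text \<open>A homomorphism \<open>h : (A, c) \<rightarrow> (B, d)\<close> is represented by the triple \<open>((A, c), (B, d), h)\<close>, because
  an arrow of a category determines its domain and codomain.\<close>

definition DiAlg ::
  "('o1, 'a1) category \<Rightarrow> ('o2, 'a2) category \<Rightarrow>
   ('o1, 'a1, 'o2, 'a2) func \<Rightarrow> ('o1, 'a1, 'o2, 'a2) func \<Rightarrow>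
   ('o1 \<times> 'a2, ('o1 \<times> 'a2) \<times> ('o1 \<times> 'a2) \<times> 'a1) category" where
  "DiAlg X Y F G =
     (let D = {(A, c). A \<in> Obj X \<and> c \<in> hom Y (FObj F A) (FObj G A)} in
      \<lparr>Obj = D,
       Arr = {((A, c), (B, d), h). (A, c) \<in> D \<and> (B, d) \<in> D \<and> h \<in> hom X A B \<and>
                FArr G h \<cdot>\<^bsub>Y\<^esub> c = d \<cdot>\<^bsub>Y\<^esub> FArr F h},
       Dom = \<lambda>(s, t, h). s,
       Cod = \<lambda>(s, t, h). t,
       Ide = \<lambda>s. (s, s, Ide X (fst s)),
       Comp = \<lambda>(_, t', g) (s, _, f). (s, t', g \<cdot>\<^bsub>X\<^esub> f)\<rparr>)"

definition Alg ::
  "('o, 'a) category \<Rightarrow> ('o, 'a, 'o, 'a) func \<Rightarrow>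
   ('o \<times> 'a, ('o \<times> 'a) \<times> ('o \<times> 'a) \<times> 'a) category" where
  "Alg X T = DiAlg X X T id_func"

definition CoAlg ::
  "('o, 'a) category \<Rightarrow> ('o, 'a, 'o, 'a) func \<Rightarrow>
   ('o \<times> 'a, ('o \<times> 'a) \<times> ('o \<times> 'a) \<times> 'a) category" where
  "CoAlg X T = DiAlg X X id_func T"


section \<open>Cloven fibrations\<close>

text \<open>\<open>Lift P u A\<close> is the chosen cartesian lifting \<open>u\<^sup>*A \<rightarrow> A\<close> of \<open>u : I \<rightarrow> P(A)\<close>.\<close>

record ('e, 'f, 'b, 'c) fibration =
  Total :: "('e, 'f) category"
  Base :: "('b, 'c) category"
  Proj :: "('e, 'f, 'b, 'c) func"
  Lift :: "'c \<Rightarrow> 'e \<Rightarrow> 'f"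

definition is_cartesian :: "('e, 'f, 'b, 'c) fibration \<Rightarrow> 'f \<Rightarrow> bool" where
  "is_cartesian P f \<longleftrightarrow> f \<in> Arr (Total P) \<and>
     (\<forall>g\<in>Arr (Total P). \<forall>v\<in>Arr (Base P).
        Cod (Total P) g = Cod (Total P) f \<and>
        Dom (Base P) v = FObj (Proj P) (Dom (Total P) g) \<and>
        Cod (Base P) v = FObj (Proj P) (Dom (Total P) f) \<and>
        FArr (Proj P) g = FArr (Proj P) f \<cdot>\<^bsub>Base P\<^esub> v \<longrightarrow>
        (\<exists>!h. h \<in> hom (Total P) (Dom (Total P) g) (Dom (Total P) f) \<and>
              FArr (Proj P) h = v \<and> f \<cdot>\<^bsub>Total P\<^esub> h = g))"

definition is_cloven_fibration :: "('e, 'f, 'b, 'c) fibration \<Rightarrow> bool" where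
  "is_cloven_fibration P \<longleftrightarrow> is_functor (Total P) (Base P) (Proj P) \<and>
     (\<forall>u\<in>Arr (Base P). \<forall>A\<in>Obj (Total P). FObj (Proj P) A = Cod (Base P) u \<longrightarrow>
        is_cartesian P (Lift P u A) \<and>
        Cod (Total P) (Lift P u A) = A \<and>
        FArr (Proj P) (Lift P u A) = u)"

definition fibre :: "('e, 'f, 'b, 'c) fibration \<Rightarrow> 'b \<Rightarrow> ('e, 'f) category" where
  "fibre P I =
     \<lparr>Obj = {A \<in> Obj (Total P). FObj (Proj P) A = I},
      Arr = {f \<in> Arr (Total P). FArr (Proj P) f = Ide (Base P) I},
      Dom = Dom (Total P),
      Cod = Cod (Total P),
      Ide = Ide (Total P),
      Comp = Comp (Total P)\<rparr>"

definition reindex :: "('e, 'f, 'b, 'c) fibration \<Rightarrow> 'c \<Rightarrow> ('e, 'f, 'e, 'f) func" where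
  "reindex P u =
     (let E = Total P; obj = \<lambda>A. Dom E (Lift P u A) in
      \<lparr>FObj = obj,
       FArr = \<lambda>f. THE g.
          g \<in> hom (fibre P (Dom (Base P) u)) (obj (Dom E f)) (obj (Cod E f)) \<and>
          Lift P u (Cod E f) \<cdot>\<^bsub>E\<^esub> g = f \<cdot>\<^bsub>E\<^esub> Lift P u (Dom E f)\<rparr>)"

text \<open>In the next four definitions the second argument is a choice of the structure in question, for
  all morphisms of the base, respectively for all fibres and all finite families of objects. Finite
  families are indexed by \<open>{1..n}\<close>; \<open>n = 0\<close> gives initial, respectively final, objects.\<close>

definition dependent_sums ::
  "('e, 'f, 'b, 'c) fibration \<Rightarrow> ('c \<Rightarrow> ('e, 'f, 'e, 'f) func) \<Rightarrow> bool" where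
  "dependent_sums P S \<longleftrightarrow>
     (\<forall>f\<in>Arr (Base P).
        adjunction (fibre P (Dom (Base P) f)) (fibre P (Cod (Base P) f)) (S f) (reindex P f))"

definition dependent_products ::
  "('e, 'f, 'b, 'c) fibration \<Rightarrow> ('c \<Rightarrow> ('e, 'f, 'e, 'f) func) \<Rightarrow> bool" where
  "dependent_products P R \<longleftrightarrow>
     (\<forall>f\<in>Arr (Base P).
        adjunction (fibre P (Cod (Base P) f)) (fibre P (Dom (Base P) f)) (reindex P f) (R f))"

definition fibrewise_coproducts ::
  "('e, 'f, 'b, 'c) fibration \<Rightarrow>
   ('b \<Rightarrow> nat \<Rightarrow> (nat \<Rightarrow> 'e) \<Rightarrow> (nat, 'e, 'f) cone) \<Rightarrow> bool" where
  "fibrewise_coproducts P cop \<longleftrightarrow>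
     (\<forall>I\<in>Obj (Base P). \<forall>n. \<forall>A \<in> {1..n} \<rightarrow>\<^sub>E Obj (fibre P I).
        is_coproduct (fibre P I) {1..n} A (cop I n A))"

definition fibrewise_products ::
  "('e, 'f, 'b, 'c) fibration \<Rightarrow>
   ('b \<Rightarrow> nat \<Rightarrow> (nat \<Rightarrow> 'e) \<Rightarrow> (nat, 'e, 'f) cone) \<Rightarrow> bool" where
  "fibrewise_products P prd \<longleftrightarrow>
     (\<forall>I\<in>Obj (Base P). \<forall>n. \<forall>A \<in> {1..n} \<rightarrow>\<^sub>E Obj (fibre P I).
        is_product (fibre P I) {1..n} A (prd I n A))"


section \<open>Inductive and coinductive data types\<close>

definition fibre_prod ::
  "('e, 'f, 'b, 'c) fibration \<Rightarrow> nat \<Rightarrow> (nat \<Rightarrow> 'b) \<Rightarrow> (nat \<Rightarrow> 'e, nat \<Rightarrow> 'f) category" where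
  "fibre_prod P n J = prod_cat {1..n} (\<lambda>k. fibre P (J k))"

definition component ::
  "nat \<Rightarrow> ('e, 'f, nat \<Rightarrow> 'e, nat \<Rightarrow> 'f) func \<Rightarrow> ('e, 'f, 'e, 'f) func" where
  "component k F = proj_func k \<circ>\<^sub>F F"

definition reindex_tuple ::
  "('e, 'f, 'b, 'c) fibration \<Rightarrow> nat \<Rightarrow> (nat \<Rightarrow> 'c) \<Rightarrow>
   ('e, 'f, nat \<Rightarrow> 'e, nat \<Rightarrow> 'f) func" where
  "reindex_tuple P n u = tuple_func {1..n} (\<lambda>k. reindex P (u k))"

definition is_inductive_data_type ::
  "('e, 'f, 'b, 'c) fibration \<Rightarrow> 'b \<Rightarrow> nat \<Rightarrow> (nat \<Rightarrow> 'b) \<Rightarrow>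
   ('e, 'f, nat \<Rightarrow> 'e, nat \<Rightarrow> 'f) func \<Rightarrow> (nat \<Rightarrow> 'c) \<Rightarrow> 'e \<times> (nat \<Rightarrow> 'f) \<Rightarrow> bool" where
  "is_inductive_data_type P I n J F u X \<longleftrightarrow>
     is_initial (DiAlg (fibre P I) (fibre_prod P n J) F (reindex_tuple P n u)) X"

definition is_coinductive_data_type ::
  "('e, 'f, 'b, 'c) fibration \<Rightarrow> 'b \<Rightarrow> nat \<Rightarrow> (nat \<Rightarrow> 'b) \<Rightarrow>
   ('e, 'f, nat \<Rightarrow> 'e, nat \<Rightarrow> 'f) func \<Rightarrow> (nat \<Rightarrow> 'c) \<Rightarrow> 'e \<times> (nat \<Rightarrow> 'f) \<Rightarrow> bool" where
  "is_coinductive_data_type P I n J F u X \<longleftrightarrow>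
     is_final (DiAlg (fibre P I) (fibre_prod P n J) (reindex_tuple P n u) F) X"

text \<open>The endofunctor \<open>\<Coprod>\<^bsub>u\<^sub>1\<^esub> \<circ> F\<^sub>1 +\<^sub>I \<dots> +\<^sub>I \<Coprod>\<^bsub>u\<^sub>n\<^esub> \<circ> F\<^sub>n\<close> of the fibre over \<open>I\<close>, and its dual.\<close>

definition sum_endofunctor ::
  "('e, 'f, 'b, 'c) fibration \<Rightarrow> ('b \<Rightarrow> nat \<Rightarrow> (nat \<Rightarrow> 'e) \<Rightarrow> (nat, 'e, 'f) cone) \<Rightarrow>
   ('c \<Rightarrow> ('e, 'f, 'e, 'f) func) \<Rightarrow> 'b \<Rightarrow> nat \<Rightarrow>
   ('e, 'f, nat \<Rightarrow> 'e, nat \<Rightarrow> 'f) func \<Rightarrow> (nat \<Rightarrow> 'c) \<Rightarrow> ('e, 'f, 'e, 'f) func" where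
  "sum_endofunctor P cop S I n F u =
     coproduct_func (fibre P I) (fibre P I) {1..n} (cop I n) (\<lambda>k. S (u k) \<circ>\<^sub>F component k F)"

definition product_endofunctor ::
  "('e, 'f, 'b, 'c) fibration \<Rightarrow> ('b \<Rightarrow> nat \<Rightarrow> (nat \<Rightarrow> 'e) \<Rightarrow> (nat, 'e, 'f) cone) \<Rightarrow>
   ('c \<Rightarrow> ('e, 'f, 'e, 'f) func) \<Rightarrow> 'b \<Rightarrow> nat \<Rightarrow>
   ('e, 'f, nat \<Rightarrow> 'e, nat \<Rightarrow> 'f) func \<Rightarrow> (nat \<Rightarrow> 'c) \<Rightarrow> ('e, 'f, 'e, 'f) func" where
  "product_endofunctor P prd R I n F u =
     product_func (fibre P I) (fibre P I) {1..n} (prd I n) (\<lambda>k. R (u k) \<circ>\<^sub>F component k F)"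

end

theory Submission
  imports Defs
begin

text \<open>Maps \<open>\<Coprod>\<^sub>k \<Coprod>\<^bsub>u\<^sub>k\<^esub> (F\<^sub>k A) \<rightarrow> B\<close> correspond to families of maps \<open>\<Coprod>\<^bsub>u\<^sub>k\<^esub> (F\<^sub>k A) \<rightarrow> B\<close>, and these, by
  adjointness, to families \<open>F\<^sub>k A \<rightarrow> u\<^sub>k\<^sup>* B\<close>, naturally in \<open>A\<close> and \<open>B\<close>. On the diagonal \<open>A = B\<close> this is
  a bijection between algebra and dialgebra structures on \<open>A\<close>, and by naturality it preserves and
  reflects homomorphisms. The coinductive half is the same argument in the opposite categories.\<close>

section \<open>Typed rules for categories and functors\<close>

lemma homD:
  assumes "f \<in> hom C A B"
  shows "f \<in> Arr C" "Dom C f = A" "Cod C f = B"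
  using assms by (auto simp: hom_def)

lemma Obj_hom:
  assumes "is_category C" "f \<in> hom C A B"
  shows "A \<in> Obj C" "B \<in> Obj C"
  using assms by (auto simp: hom_def is_category_def)

lemma Ide_hom: "is_category C \<Longrightarrow> A \<in> Obj C \<Longrightarrow> Ide C A \<in> hom C A A"
  by (auto simp: is_category_def)

lemma Comp_hom:
  "is_category C \<Longrightarrow> f \<in> hom C A B \<Longrightarrow> g \<in> hom C B D \<Longrightarrow> g \<cdot>\<^bsub>C\<^esub> f \<in> hom C A D"
  by (auto simp: is_category_def hom_def)

lemma Comp_Ide_right: "is_category C \<Longrightarrow> f \<in> hom C A B \<Longrightarrow> f \<cdot>\<^bsub>C\<^esub> Ide C A = f"
  by (auto simp: is_category_def hom_def)

lemma Comp_Ide_left: "is_category C \<Longrightarrow> f \<in> hom C A B \<Longrightarrow> Ide C B \<cdot>\<^bsub>C\<^esub> f = f"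
  by (auto simp: is_category_def hom_def)

lemma Comp_assoc:
  "is_category C \<Longrightarrow> f \<in> hom C A B \<Longrightarrow> g \<in> hom C B B' \<Longrightarrow> h \<in> hom C B' B'' \<Longrightarrow>
    (h \<cdot>\<^bsub>C\<^esub> g) \<cdot>\<^bsub>C\<^esub> f = h \<cdot>\<^bsub>C\<^esub> (g \<cdot>\<^bsub>C\<^esub> f)"
  by (auto simp: is_category_def hom_def)

lemma is_categoryI:
  assumes "\<And>f. f \<in> Arr C \<Longrightarrow> Dom C f \<in> Obj C \<and> Cod C f \<in> Obj C"
    and "\<And>A. A \<in> Obj C \<Longrightarrow> Ide C A \<in> hom C A A"
    and "\<And>A B D f g. f \<in> hom C A B \<Longrightarrow> g \<in> hom C B D \<Longrightarrow> g \<cdot>\<^bsub>C\<^esub> f \<in> hom C A D"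
    and "\<And>A B f. f \<in> hom C A B \<Longrightarrow> f \<cdot>\<^bsub>C\<^esub> Ide C A = f \<and> Ide C B \<cdot>\<^bsub>C\<^esub> f = f"
    and "\<And>A B B' B'' f g h. f \<in> hom C A B \<Longrightarrow> g \<in> hom C B B' \<Longrightarrow> h \<in> hom C B' B'' \<Longrightarrow>
      (h \<cdot>\<^bsub>C\<^esub> g) \<cdot>\<^bsub>C\<^esub> f = h \<cdot>\<^bsub>C\<^esub> (g \<cdot>\<^bsub>C\<^esub> f)"
  shows "is_category C"
  using assms unfolding is_category_def hom_def by auto

lemma functor_cat:
  assumes "is_functor C D F"
  shows "is_category C" "is_category D"
  using assms by (auto simp: is_functor_def)

lemma functor_Obj: "is_functor C D F \<Longrightarrow> A \<in> Obj C \<Longrightarrow> FObj F A \<in> Obj D"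
  by (auto simp: is_functor_def)

lemma functor_hom:
  "is_functor C D F \<Longrightarrow> f \<in> hom C A B \<Longrightarrow> FArr F f \<in> hom D (FObj F A) (FObj F B)"
  by (auto simp: is_functor_def hom_def)

lemma functor_Ide: "is_functor C D F \<Longrightarrow> A \<in> Obj C \<Longrightarrow> FArr F (Ide C A) = Ide D (FObj F A)"
  by (auto simp: is_functor_def)

lemma functor_Comp:
  "is_functor C D F \<Longrightarrow> f \<in> hom C A B \<Longrightarrow> g \<in> hom C B B' \<Longrightarrow>
    FArr F (g \<cdot>\<^bsub>C\<^esub> f) = FArr F g \<cdot>\<^bsub>D\<^esub> FArr F f"
  by (auto simp: is_functor_def hom_def)

lemma is_functorI:
  assumes "is_category C" "is_category D"
    and "\<And>A. A \<in> Obj C \<Longrightarrow> FObj F A \<in> Obj D"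
    and "\<And>A B f. f \<in> hom C A B \<Longrightarrow> FArr F f \<in> hom D (FObj F A) (FObj F B)"
    and "\<And>A. A \<in> Obj C \<Longrightarrow> FArr F (Ide C A) = Ide D (FObj F A)"
    and "\<And>A B B' f g. f \<in> hom C A B \<Longrightarrow> g \<in> hom C B B' \<Longrightarrow>
      FArr F (g \<cdot>\<^bsub>C\<^esub> f) = FArr F g \<cdot>\<^bsub>D\<^esub> FArr F f"
  shows "is_functor C D F"
  using assms unfolding is_functor_def hom_def by auto

lemma is_functor_id: "is_category C \<Longrightarrow> is_functor C C id_func"
  by (rule is_functorI) (auto simp: id_func_def)

lemma is_functor_comp:
  assumes F: "is_functor C D F" and G: "is_functor D E G"
  shows "is_functor C E (G \<circ>\<^sub>F F)"
proof (rule is_functorI)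
  fix A B B' f g assume "f \<in> hom C A B" "g \<in> hom C B B'"
  then show "FArr (G \<circ>\<^sub>F F) (g \<cdot>\<^bsub>C\<^esub> f) = FArr (G \<circ>\<^sub>F F) g \<cdot>\<^bsub>E\<^esub> FArr (G \<circ>\<^sub>F F) f"
    by (simp add: comp_func_def functor_Comp[OF F] functor_Comp[OF G functor_hom[OF F] functor_hom[OF F]])
qed (use functor_cat[OF F] functor_cat[OF G] functor_Obj[OF F] functor_Obj[OF G]
      functor_hom[OF F] functor_hom[OF G] functor_Ide[OF F] functor_Ide[OF G] in
      \<open>auto simp: comp_func_def\<close>)

section \<open>Products of categories\<close>

text \<open>\<open>Dom\<close> and \<open>Cod\<close> in the product return restricted families, so
  a componentwise check determines them only when \<open>A\<close> and \<open>B\<close> are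
  themselves extensional.\<close>

lemma hom_prod_cat:
  fixes Y :: "'k \<Rightarrow> ('o, 'a) category"
  assumes "A \<in> extensional K" "B \<in> extensional K"
  shows "f \<in> hom (prod_cat K Y) A B \<longleftrightarrow>
    f \<in> extensional K \<and> (\<forall>k\<in>K. f k \<in> hom (Y k) (A k) (B k))"
proof -
  have "restrict g K = h \<longleftrightarrow> (\<forall>k\<in>K. g k = h k)" if "h \<in> extensional K" for g h :: "_ \<Rightarrow> 'o"
    by (auto intro: extensionalityI[OF restrict_extensional that])
  then show ?thesis
    using assms by (auto simp: hom_def prod_cat_def PiE_iff)
qed

lemma hom_prod_cat_app:
  assumes "f \<in> hom (prod_cat K Y) A B" "k \<in> K"
  shows "f k \<in> hom (Y k) (A k) (B k)"
  using assms by (auto simp: hom_def prod_cat_def)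

lemma prod_cat_sel:
  "Obj (prod_cat K Y) = (\<Pi>\<^sub>E k\<in>K. Obj (Y k))"
  "Ide (prod_cat K Y) A = (\<lambda>k\<in>K. Ide (Y k) (A k))"
  "g \<cdot>\<^bsub>prod_cat K Y\<^esub> f = (\<lambda>k\<in>K. g k \<cdot>\<^bsub>Y k\<^esub> f k)"
  by (simp_all add: prod_cat_def)

lemma is_category_prod_cat:
  assumes "\<And>k. k \<in> K \<Longrightarrow> is_category (Y k)"
  shows "is_category (prod_cat K Y)"
proof (rule is_categoryI)
  show "Dom (prod_cat K Y) f \<in> Obj (prod_cat K Y) \<and> Cod (prod_cat K Y) f \<in> Obj (prod_cat K Y)"
    if "f \<in> Arr (prod_cat K Y)" for f
    using that assms by (auto simp: prod_cat_def is_category_def PiE_iff)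
  show "Ide (prod_cat K Y) A \<in> hom (prod_cat K Y) A A" if "A \<in> Obj (prod_cat K Y)" for A
    using that assms by (subst hom_prod_cat) (auto simp: prod_cat_sel PiE_iff intro: Ide_hom)
next
  fix A B D f g assume "f \<in> hom (prod_cat K Y) A B" "g \<in> hom (prod_cat K Y) B D"
  moreover from this have "A \<in> extensional K" "D \<in> extensional K"
    by (auto simp: hom_def prod_cat_def)
  ultimately show "g \<cdot>\<^bsub>prod_cat K Y\<^esub> f \<in> hom (prod_cat K Y) A D"
    using assms by (subst hom_prod_cat) (auto simp: prod_cat_sel intro: Comp_hom hom_prod_cat_app)
next
  fix A B f assume f: "f \<in> hom (prod_cat K Y) A B"
  then have "f \<in> extensional K" by (auto simp: hom_def prod_cat_def PiE_iff)
  then show "f \<cdot>\<^bsub>prod_cat K Y\<^esub> Ide (prod_cat K Y) A = f \<and>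
      Ide (prod_cat K Y) B \<cdot>\<^bsub>prod_cat K Y\<^esub> f = f"
    by (intro conjI; intro extensionalityI[of _ K])
      (simp_all add: prod_cat_sel Comp_Ide_left[OF assms hom_prod_cat_app[OF f]]
        Comp_Ide_right[OF assms hom_prod_cat_app[OF f]])
next
  fix A B B' B'' f g h
  assume f: "f \<in> hom (prod_cat K Y) A B" and g: "g \<in> hom (prod_cat K Y) B B'"
    and h: "h \<in> hom (prod_cat K Y) B' B''"
  show "(h \<cdot>\<^bsub>prod_cat K Y\<^esub> g) \<cdot>\<^bsub>prod_cat K Y\<^esub> f = h \<cdot>\<^bsub>prod_cat K Y\<^esub> (g \<cdot>\<^bsub>prod_cat K Y\<^esub> f)"
    unfolding prod_cat_sel
    by (intro restrict_ext) (simp add: Comp_assoc[OF assms hom_prod_cat_app[OF f]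
        hom_prod_cat_app[OF g] hom_prod_cat_app[OF h]])
qed

lemma is_functor_proj:
  assumes "\<And>k. k \<in> K \<Longrightarrow> is_category (Y k)" "k \<in> K"
  shows "is_functor (prod_cat K Y) (Y k) (proj_func k)"
  by (rule is_functorI)
    (use assms is_category_prod_cat[OF assms(1)] in
      \<open>auto simp: proj_func_def prod_cat_sel dest: hom_prod_cat_app\<close>)

lemma is_functor_tuple:
  assumes X: "is_category X" and G: "\<And>k. k \<in> K \<Longrightarrow> is_functor X (Y k) (G k)"
  shows "is_functor X (prod_cat K Y) (tuple_func K G)"
proof (rule is_functorI[OF X is_category_prod_cat])
  show "is_category (Y k)" if "k \<in> K" for k using functor_cat[OF G[OF that]] by simp
  show "FArr (tuple_func K G) f \<in> hom (prod_cat K Y) (FObj (tuple_func K G) A) (FObj (tuple_func K G) B)"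
    if "f \<in> hom X A B" for A B f
    using that by (subst hom_prod_cat) (auto simp: tuple_func_def intro: functor_hom G)
qed (auto simp: tuple_func_def prod_cat_sel restrict_def fun_eq_iff
    intro: functor_Obj[OF G] functor_Ide[OF G] functor_Comp[OF G])


section \<open>Opposite categories\<close>

text \<open>Objects and arrows keep their types and carriers, so a record describing a functor also
  describes its opposite functor, and one cone record serves as cone and cocone.\<close>

definition op_cat :: "('o, 'a) category \<Rightarrow> ('o, 'a) category" where
  "op_cat C = \<lparr>Obj = Obj C, Arr = Arr C, Dom = Cod C, Cod = Dom C, Ide = Ide C,
     Comp = \<lambda>g f. f \<cdot>\<^bsub>C\<^esub> g\<rparr>"

lemma op_cat_sel [simp]:
  "Obj (op_cat C) = Obj C" "Arr (op_cat C) = Arr C" "Dom (op_cat C) = Cod C"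
  "Cod (op_cat C) = Dom C" "Ide (op_cat C) = Ide C" "g \<cdot>\<^bsub>op_cat C\<^esub> f = f \<cdot>\<^bsub>C\<^esub> g"
  by (simp_all add: op_cat_def)

text \<open>An equality of records, not merely an isomorphism: every transfer to opposite categories
  can also be read backwards.\<close>

lemma op_op_cat [simp]: "op_cat (op_cat C) = C"
  by (simp add: op_cat_def)

lemma hom_op_cat [simp]: "hom (op_cat C) A B = hom C B A"
  by (auto simp: hom_def)

lemma op_prod_cat: "op_cat (prod_cat K Y) = prod_cat K (\<lambda>k. op_cat (Y k))"
  by (simp add: op_cat_def prod_cat_def)

lemma is_category_op: "is_category C \<Longrightarrow> is_category (op_cat C)"
  by (rule is_categoryI)
    (auto intro: Ide_hom Comp_hom Comp_Ide_left Comp_Ide_right Comp_assoc[symmetric] Obj_hom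
       simp: is_category_def)

lemma is_functor_op: "is_functor C D F \<Longrightarrow> is_functor (op_cat C) (op_cat D) F"
  by (rule is_functorI)
    (auto intro: is_category_op functor_Obj functor_hom functor_Ide functor_Comp dest: functor_cat)

lemma is_coproduct_op: "is_coproduct (op_cat C) K A Z \<longleftrightarrow> is_product C K A Z"
  by (simp add: is_coproduct_def is_product_def)

text \<open>Reversal exchanges \<open>Dom\<close> with \<open>Cod\<close> and flips each composite,
  which turns one definite description into the other; the functors agree literally, including the
  arrow part.\<close>

lemma coproduct_func_op:
  "coproduct_func (op_cat X) (op_cat C) K prd H = product_func X C K prd H"
  by (simp add: coproduct_func_def product_func_def Let_def)

lemma is_initial_op: "is_initial (op_cat C) Z \<longleftrightarrow> is_final C Z"
  by (simp add: is_initial_def is_final_def)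

text \<open>The inverse of the transposition is the transposition of the opposite adjunction; its
  naturality comes from applying the inverse to the naturality of \<open>\<phi>\<close>.\<close>

lemma adjunction_op:
  assumes "adjunction C D L R"
  shows "adjunction (op_cat D) (op_cat C) R L"
proof -
  from assms have L: "is_functor C D L" and R: "is_functor D C R"
    by (auto simp: adjunction_def)
  note CD = functor_cat[OF L]
  from assms obtain \<phi> where bij: "\<And>A B. A \<in> Obj C \<Longrightarrow> B \<in> Obj D \<Longrightarrow>
      bij_betw (\<phi> A B) (hom D (FObj L A) B) (hom C A (FObj R B))"
    and nat: "\<And>A A' B B' a b f. A \<in> Obj C \<Longrightarrow> A' \<in> Obj C \<Longrightarrow> B \<in> Obj D \<Longrightarrow> B' \<in> Obj D \<Longrightarrow>
      a \<in> hom C A' A \<Longrightarrow> b \<in> hom D B B' \<Longrightarrow> f \<in> hom D (FObj L A) B \<Longrightarrow>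
      \<phi> A' B' ((b \<cdot>\<^bsub>D\<^esub> f) \<cdot>\<^bsub>D\<^esub> FArr L a) = (FArr R b \<cdot>\<^bsub>C\<^esub> \<phi> A B f) \<cdot>\<^bsub>C\<^esub> a"
    unfolding adjunction_def by blast
  define \<psi> where "\<psi> B A = inv_into (hom D (FObj L A) B) (\<phi> A B)" for B A
  have bij': "bij_betw (\<psi> B A) (hom C A (FObj R B)) (hom D (FObj L A) B)"
    if "A \<in> Obj C" "B \<in> Obj D" for A B
    unfolding \<psi>_def by (rule bij_betw_inv_into[OF bij[OF that]])
  \<comment> \<open>In the opposite categories the brackets fall on the other side, hence this form
    of the naturality square.\<close>
  have "\<psi> B' A' (FArr R b \<cdot>\<^bsub>C\<^esub> (g \<cdot>\<^bsub>C\<^esub> a)) = b \<cdot>\<^bsub>D\<^esub> (\<psi> B A g \<cdot>\<^bsub>D\<^esub> FArr L a)"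
    if o: "A \<in> Obj C" "A' \<in> Obj C" "B \<in> Obj D" "B' \<in> Obj D"
      and a: "a \<in> hom C A' A" and b: "b \<in> hom D B B'" and g: "g \<in> hom C A (FObj R B)"
    for A A' B B' a b g
  proof -
    let ?f = "\<psi> B A g"
    have f: "?f \<in> hom D (FObj L A) B" using bij'[OF o(1,3)] g by (auto dest: bij_betwE)
    have pf: "\<phi> A B ?f = g"
      unfolding \<psi>_def using bij[OF o(1,3)] g by (rule bij_betw_inv_into_right)
    have La: "FArr L a \<in> hom D (FObj L A') (FObj L A)" using functor_hom[OF L a] .
    have "FArr R b \<cdot>\<^bsub>C\<^esub> (g \<cdot>\<^bsub>C\<^esub> a) = (FArr R b \<cdot>\<^bsub>C\<^esub> g) \<cdot>\<^bsub>C\<^esub> a"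
      using Comp_assoc[OF CD(1) a g functor_hom[OF R b]] by simp
    also have "\<dots> = \<phi> A' B' ((b \<cdot>\<^bsub>D\<^esub> ?f) \<cdot>\<^bsub>D\<^esub> FArr L a)"
      using nat[OF o a b f] pf by simp
    \<comment> \<open>Cancelling the inverse against \<open>\<phi>\<close> requires the composite on
      the right to lie in the hom-set on which \<open>\<phi>\<close> was inverted.\<close>
    finally have "\<psi> B' A' (FArr R b \<cdot>\<^bsub>C\<^esub> (g \<cdot>\<^bsub>C\<^esub> a)) = (b \<cdot>\<^bsub>D\<^esub> ?f) \<cdot>\<^bsub>D\<^esub> FArr L a"
      unfolding \<psi>_def
      using bij_betw_inv_into_left[OF bij[OF o(2,4)] Comp_hom[OF CD(2) La Comp_hom[OF CD(2) f b]]]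
      by (simp add: \<psi>_def)
    then show ?thesis using Comp_assoc[OF CD(2) La f b] by simp
  qed
  with bij' show ?thesis
    unfolding adjunction_def
    by (intro conjI is_functor_op L R exI[of _ \<psi>]) simp_all
qed


section \<open>Isomorphisms of categories\<close>

lemma isomorphic_categories_sym: "isomorphic_categories C D \<Longrightarrow> isomorphic_categories D C"
  unfolding isomorphic_categories_def by blast

lemma isomorphic_categories_op:
  "isomorphic_categories C D \<Longrightarrow> isomorphic_categories (op_cat C) (op_cat D)"
  unfolding isomorphic_categories_def func_eq_def op_cat_sel by (metis is_functor_op)

text \<open>The image \<open>F Z\<close> of an initial object is initial: arrows
  \<open>F Z \<rightarrow> Y\<close> correspond to arrows \<open>Z \<rightarrow> G Y\<close> because
  both round trips are identities.\<close>

lemma isomorphic_categories_initial: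
  assumes "isomorphic_categories C D" "\<exists>Z. is_initial C Z"
  shows "\<exists>Z. is_initial D Z"
proof -
  obtain F G where F: "is_functor C D F" and G: "is_functor D C G"
    and GF: "func_eq C (G \<circ>\<^sub>F F) id_func" and FG: "func_eq D (F \<circ>\<^sub>F G) id_func"
    using assms(1) unfolding isomorphic_categories_def by blast
  obtain Z where Z: "Z \<in> Obj C" and ex1: "\<And>Y. Y \<in> Obj C \<Longrightarrow> \<exists>!f. f \<in> hom C Z Y"
    using assms(2) unfolding is_initial_def by blast
  have GFZ: "FObj G (FObj F Z) = Z"
    using GF Z by (simp add: func_eq_def comp_func_def id_func_def)
  have "\<exists>!f. f \<in> hom D (FObj F Z) Y" if Y: "Y \<in> Obj D" for Y
  proof -
    note ex1Y = ex1[OF functor_Obj[OF G Y]]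
    have FGY: "FObj F (FObj G Y) = Y"
      using FG Y by (simp add: func_eq_def comp_func_def id_func_def)
    have G_hom: "FArr G h \<in> hom C Z (FObj G Y)" "FArr F (FArr G h) = h"
      if "h \<in> hom D (FObj F Z) Y" for h
      using functor_hom[OF G that] GFZ FG homD(1)[OF that]
      by (simp_all add: func_eq_def comp_func_def id_func_def)
    \<comment> \<open>Existence comes from \<open>FArr F g\<close>. For uniqueness,
      \<open>FArr G\<close> sends any two candidates to the same arrow, and applying
      \<open>FArr F\<close> recovers them.\<close>
    from ex1Y obtain g where "g \<in> hom C Z (FObj G Y)" by blast
    with functor_hom[OF F this] FGY show ?thesis
      using G_hom ex1Y by metis
  qed
  then show ?thesis
    unfolding is_initial_def using functor_Obj[OF F Z] by blast
qed

lemma isomorphic_categories_initial_iff: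
  "isomorphic_categories C D \<Longrightarrow> (\<exists>Z. is_initial C Z) \<longleftrightarrow> (\<exists>Z. is_initial D Z)"
  by (blast intro: isomorphic_categories_initial dest: isomorphic_categories_sym)

text \<open>Final objects are initial objects of the opposite category.\<close>

lemma isomorphic_categories_final_iff:
  "isomorphic_categories C D \<Longrightarrow> (\<exists>Z. is_final C Z) \<longleftrightarrow> (\<exists>Z. is_final D Z)"
  using isomorphic_categories_initial_iff[OF isomorphic_categories_op]
  by (simp add: is_initial_op)


section \<open>Dialgebras\<close>

lemma DiAlg_Obj: "(A, c) \<in> Obj (DiAlg X Y F G) \<longleftrightarrow> A \<in> Obj X \<and> c \<in> hom Y (FObj F A) (FObj G A)"
  by (simp add: DiAlg_def)

lemma DiAlg_hom:
  "t \<in> hom (DiAlg X Y F G) (A, c) (B, d) \<longleftrightarrow>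
    (\<exists>h. t = ((A, c), (B, d), h) \<and> h \<in> hom X A B \<and>
      A \<in> Obj X \<and> c \<in> hom Y (FObj F A) (FObj G A) \<and>
      B \<in> Obj X \<and> d \<in> hom Y (FObj F B) (FObj G B) \<and>
      FArr G h \<cdot>\<^bsub>Y\<^esub> c = d \<cdot>\<^bsub>Y\<^esub> FArr F h)"
  \<comment> \<open>Only the outer hom-set is unfolded first, to expose the triple; the hom-sets of
    \<open>X\<close> and \<open>Y\<close> stay folded until the remaining goals need them.\<close>
  by (auto simp: DiAlg_def hom_def[of "DiAlg X Y F G" for X Y F G] Let_def)
    (auto simp: hom_def)

lemma DiAlg_sel:
  "Ide (DiAlg X Y F G) (A, c) = ((A, c), (A, c), Ide X A)"
  "(t, t', g) \<cdot>\<^bsub>DiAlg X Y F G\<^esub> (s, s', f) = (s, t', g \<cdot>\<^bsub>X\<^esub> f)"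
  by (simp_all add: DiAlg_def)

lemma is_category_DiAlg:
  assumes F: "is_functor X Y F" and G: "is_functor X Y G"
  shows "is_category (DiAlg X Y F G)"
proof (rule is_categoryI)
  note XY = functor_cat[OF F]
  show "Dom (DiAlg X Y F G) t \<in> Obj (DiAlg X Y F G) \<and> Cod (DiAlg X Y F G) t \<in> Obj (DiAlg X Y F G)"
    if "t \<in> Arr (DiAlg X Y F G)" for t
    using that by (auto simp: DiAlg_def)
  show "Ide (DiAlg X Y F G) s \<in> hom (DiAlg X Y F G) s s" if "s \<in> Obj (DiAlg X Y F G)" for s
    using that
    by (cases s) (auto simp: DiAlg_Obj DiAlg_hom DiAlg_sel Ide_hom[OF XY(1)] functor_Ide[OF F]
        functor_Ide[OF G] Comp_Ide_left[OF XY(2)] Comp_Ide_right[OF XY(2)])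
  show "t \<cdot>\<^bsub>DiAlg X Y F G\<^esub> Ide (DiAlg X Y F G) s = t \<and> Ide (DiAlg X Y F G) s' \<cdot>\<^bsub>DiAlg X Y F G\<^esub> t = t"
    if "t \<in> hom (DiAlg X Y F G) s s'" for t s s'
    using that
    by (cases s; cases s')
      (auto simp: DiAlg_hom DiAlg_sel Comp_Ide_left[OF XY(1)] Comp_Ide_right[OF XY(1)])
  show "t' \<cdot>\<^bsub>DiAlg X Y F G\<^esub> t \<in> hom (DiAlg X Y F G) s s''"
    if t: "t \<in> hom (DiAlg X Y F G) s s'" and t': "t' \<in> hom (DiAlg X Y F G) s' s''" for t t' s s' s''
  proof -
    obtain A c B d E e where s: "s = (A, c)" "s' = (B, d)" "s'' = (E, e)"
      by (cases s, cases s', cases s'')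
    from t obtain f where f: "t = ((A, c), (B, d), f)" "f \<in> hom X A B" "A \<in> Obj X"
      "c \<in> hom Y (FObj F A) (FObj G A)" "d \<in> hom Y (FObj F B) (FObj G B)"
      "FArr G f \<cdot>\<^bsub>Y\<^esub> c = d \<cdot>\<^bsub>Y\<^esub> FArr F f"
      by (auto simp: DiAlg_hom s)
    from t' obtain g where g: "t' = ((B, d), (E, e), g)" "g \<in> hom X B E" "E \<in> Obj X"
      "e \<in> hom Y (FObj F E) (FObj G E)" "FArr G g \<cdot>\<^bsub>Y\<^esub> d = e \<cdot>\<^bsub>Y\<^esub> FArr F g"
      by (auto simp: DiAlg_hom s)
    note h = functor_hom[OF F f(2)] functor_hom[OF F g(2)]
      functor_hom[OF G f(2)] functor_hom[OF G g(2)]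
    \<comment> \<open>The homomorphism squares of \<open>f\<close> and \<open>g\<close> are pasted
      along the structure map \<open>d\<close>.\<close>
    have "FArr G (g \<cdot>\<^bsub>X\<^esub> f) \<cdot>\<^bsub>Y\<^esub> c = FArr G g \<cdot>\<^bsub>Y\<^esub> (FArr G f \<cdot>\<^bsub>Y\<^esub> c)"
      by (simp add: functor_Comp[OF G f(2) g(2)] Comp_assoc[OF XY(2) f(4) h(3,4)])
    also have "\<dots> = (FArr G g \<cdot>\<^bsub>Y\<^esub> d) \<cdot>\<^bsub>Y\<^esub> FArr F f"
      by (simp add: f(6) Comp_assoc[OF XY(2) h(1) f(5) h(4)])
    also have "\<dots> = e \<cdot>\<^bsub>Y\<^esub> FArr F (g \<cdot>\<^bsub>X\<^esub> f)"
      by (simp add: g(5) Comp_assoc[OF XY(2) h(1,2) g(4)] functor_Comp[OF F f(2) g(2)])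
    finally show ?thesis
      using f g by (simp add: s DiAlg_hom DiAlg_sel Comp_hom[OF XY(1)])
  qed
  show "(t'' \<cdot>\<^bsub>DiAlg X Y F G\<^esub> t') \<cdot>\<^bsub>DiAlg X Y F G\<^esub> t = t'' \<cdot>\<^bsub>DiAlg X Y F G\<^esub> (t' \<cdot>\<^bsub>DiAlg X Y F G\<^esub> t)"
    if "t \<in> hom (DiAlg X Y F G) r s" "t' \<in> hom (DiAlg X Y F G) s s'"
      "t'' \<in> hom (DiAlg X Y F G) s' s''" for t t' t'' r s s' s''
    using that
    by (cases r; cases s; cases s'; cases s'')
      (auto simp: DiAlg_hom DiAlg_sel intro: Comp_assoc[OF XY(1)])
qed

section \<open>Natural bijections of hom-sets and the induced isomorphism of dialgebras\<close>

text \<open>A natural isomorphism between the profunctors \<open>hom Y (F -) (G -)\<close> and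
  \<open>hom Z (F' -) (G' -)\<close>. Dialgebra structures live on the diagonal, but two objects are
  needed since the homomorphism equation for \<open>A \<rightarrow> B\<close> compares arrows
  \<open>F A \<rightarrow> G B\<close>.\<close>

definition hom_iso ::
  "('o1, 'a1) category \<Rightarrow>
   ('o2, 'a2) category \<Rightarrow> ('o1, 'a1, 'o2, 'a2) func \<Rightarrow> ('o1, 'a1, 'o2, 'a2) func \<Rightarrow>
   ('o3, 'a3) category \<Rightarrow> ('o1, 'a1, 'o3, 'a3) func \<Rightarrow> ('o1, 'a1, 'o3, 'a3) func \<Rightarrow>
   ('o1 \<Rightarrow> 'o1 \<Rightarrow> 'a2 \<Rightarrow> 'a3) \<Rightarrow> bool" where
  "hom_iso X Y F G Z F' G' \<Phi> \<longleftrightarrow>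
     (\<forall>A\<in>Obj X. \<forall>B\<in>Obj X.
        bij_betw (\<Phi> A B) (hom Y (FObj F A) (FObj G B)) (hom Z (FObj F' A) (FObj G' B))) \<and>
     (\<forall>A A' B B' a b f. a \<in> hom X A' A \<longrightarrow> b \<in> hom X B B' \<longrightarrow> f \<in> hom Y (FObj F A) (FObj G B) \<longrightarrow>
        \<Phi> A' B' ((FArr G b \<cdot>\<^bsub>Y\<^esub> f) \<cdot>\<^bsub>Y\<^esub> FArr F a) = (FArr G' b \<cdot>\<^bsub>Z\<^esub> \<Phi> A B f) \<cdot>\<^bsub>Z\<^esub> FArr F' a)"

text \<open>Reversing arrows exchanges the functors in source and target position, and with them the
  two object arguments of \<open>\<Phi>\<close>. Associativity in \<open>Y\<close> and
  \<open>Z\<close> restores the bracketing.\<close>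

lemma hom_iso_op:
  assumes F: "is_functor X Y F" and G: "is_functor X Y G"
    and F': "is_functor X Z F'" and G': "is_functor X Z G'"
    and iso: "hom_iso (op_cat X) (op_cat Y) F G (op_cat Z) F' G' \<Phi>"
  shows "hom_iso X Y G F Z G' F' (\<lambda>A B. \<Phi> B A)"
proof -
  have bij: "bij_betw (\<Phi> B A) (hom Y (FObj G A) (FObj F B)) (hom Z (FObj G' A) (FObj F' B))"
    if "A \<in> Obj X" "B \<in> Obj X" for A B
    using that iso unfolding hom_iso_def by simp
  have "\<Phi> B' A' ((FArr F b \<cdot>\<^bsub>Y\<^esub> f) \<cdot>\<^bsub>Y\<^esub> FArr G a) = (FArr F' b \<cdot>\<^bsub>Z\<^esub> \<Phi> B A f) \<cdot>\<^bsub>Z\<^esub> FArr G' a"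
    if a: "a \<in> hom X A' A" and b: "b \<in> hom X B B'" and f: "f \<in> hom Y (FObj G A) (FObj F B)"
    for A A' B B' a b f
  proof -
    have \<Phi>f: "\<Phi> B A f \<in> hom Z (FObj G' A) (FObj F' B)"
      using bij_betwE[OF bij] f Obj_hom[OF functor_cat(1)[OF F] a]
        Obj_hom[OF functor_cat(1)[OF F] b] by blast
    have "\<Phi> B' A' (FArr F b \<cdot>\<^bsub>Y\<^esub> (f \<cdot>\<^bsub>Y\<^esub> FArr G a)) = FArr F' b \<cdot>\<^bsub>Z\<^esub> (\<Phi> B A f \<cdot>\<^bsub>Z\<^esub> FArr G' a)"
      using iso a b f unfolding hom_iso_def by simp
    then show ?thesis
      using Comp_assoc[OF functor_cat(2)[OF G] functor_hom[OF G a] f functor_hom[OF F b]]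
        Comp_assoc[OF functor_cat(2)[OF G'] functor_hom[OF G' a] \<Phi>f functor_hom[OF F' b]]
      by simp
  qed
  with bij show ?thesis unfolding hom_iso_def by blast
qed

text \<open>Two-sided naturality with the identity of \<open>B\<close> as second arrow.\<close>

lemma hom_iso_natural_left:
  assumes G: "is_functor X Y G" and G': "is_functor X Z G'" and F: "is_functor X Y F"
    and iso: "hom_iso X Y F G Z F' G' \<Phi>"
    and a: "a \<in> hom X A' A" and f: "f \<in> hom Y (FObj F A) (FObj G B)" and B: "B \<in> Obj X"
  shows "\<Phi> A' B (f \<cdot>\<^bsub>Y\<^esub> FArr F a) = \<Phi> A B f \<cdot>\<^bsub>Z\<^esub> FArr F' a"
proof -
  note X = functor_cat(1)[OF F]
  have "\<Phi> A B f \<in> hom Z (FObj F' A) (FObj G' B)"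
    using iso f B Obj_hom(2)[OF X a] unfolding hom_iso_def by (blast dest: bij_betwE)
  moreover have "\<Phi> A' B ((FArr G (Ide X B) \<cdot>\<^bsub>Y\<^esub> f) \<cdot>\<^bsub>Y\<^esub> FArr F a) =
      (FArr G' (Ide X B) \<cdot>\<^bsub>Z\<^esub> \<Phi> A B f) \<cdot>\<^bsub>Z\<^esub> FArr F' a"
    using iso a f Ide_hom[OF X B] unfolding hom_iso_def by blast
  ultimately show ?thesis
    using f by (simp add: functor_Ide[OF G B] functor_Ide[OF G' B]
        Comp_Ide_left[OF functor_cat(2)[OF G]] Comp_Ide_left[OF functor_cat(2)[OF G']])
qed

text \<open>Dual to the rule for precomposition: reversal makes \<open>b\<close> act on the source
  side.\<close>

lemma hom_iso_natural_right:
  assumes F: "is_functor X Y F" and F': "is_functor X Z F'"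
    and G: "is_functor X Y G" and G': "is_functor X Z G'"
    and iso: "hom_iso X Y F G Z F' G' \<Phi>"
    and b: "b \<in> hom X B B'" and f: "f \<in> hom Y (FObj F A) (FObj G B)" and A: "A \<in> Obj X"
  shows "\<Phi> A B' (FArr G b \<cdot>\<^bsub>Y\<^esub> f) = FArr G' b \<cdot>\<^bsub>Z\<^esub> \<Phi> A B f"
proof -
  have "hom_iso (op_cat X) (op_cat Y) G F (op_cat Z) G' F' (\<lambda>A B. \<Phi> B A)"
    by (rule hom_iso_op) (use iso in \<open>auto intro: is_functor_op assms\<close>)
  from hom_iso_natural_left[OF is_functor_op[OF F] is_functor_op[OF F'] is_functor_op[OF G] this]
  show ?thesis using b f A by simp
qed

text \<open>On the diagonal \<open>\<Phi>\<close> is a bijection of structures on each object.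
  Between two objects it is injective and natural, so a homomorphism equation holds before applying
  it exactly if it holds after.\<close>

lemma isomorphic_DiAlg:
  fixes X :: "('o, 'a) category"
  assumes F: "is_functor X Y F" and G: "is_functor X Y G"
    and F': "is_functor X Z F'" and G': "is_functor X Z G'"
    and iso: "hom_iso X Y F G Z F' G' \<Phi>"
  shows "isomorphic_categories (DiAlg X Y F G) (DiAlg X Z F' G')"
proof -
  define \<Psi> where "\<Psi> A = inv_into (hom Y (FObj F A) (FObj G A)) (\<Phi> A A)" for A
  define M where "M = (\<lambda>(A, c). (A, \<Phi> A A c))"
  define N where "N = (\<lambda>(A, c). (A, \<Psi> A c))"
  \<comment> \<open>Both functors alter only the structure maps and leave the underlying arrow of
    \<open>X\<close> fixed; preservation of identities and composites is then immediate.\<close>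
  define S where "S = \<lparr>FObj = M, FArr = \<lambda>(s, t, h :: 'a). (M s, M t, h)\<rparr>"
  define T where "T = \<lparr>FObj = N, FArr = \<lambda>(s, t, h :: 'a). (N s, N t, h)\<rparr>"
  have bij: "bij_betw (\<Phi> A B) (hom Y (FObj F A) (FObj G B)) (hom Z (FObj F' A) (FObj G' B))"
    if "A \<in> Obj X" "B \<in> Obj X" for A B
    using iso that unfolding hom_iso_def by blast
  have \<Phi>: "\<Phi> A A c \<in> hom Z (FObj F' A) (FObj G' A)" "\<Psi> A (\<Phi> A A c) = c"
    if "A \<in> Obj X" "c \<in> hom Y (FObj F A) (FObj G A)" for A c
    using bij[OF that(1,1)] that(2)
    by (auto simp: \<Psi>_def bij_betw_inv_into_left dest: bij_betwE)
  have \<Psi>: "\<Psi> A c \<in> hom Y (FObj F A) (FObj G A)" "\<Phi> A A (\<Psi> A c) = c"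
    if "A \<in> Obj X" "c \<in> hom Z (FObj F' A) (FObj G' A)" for A c
    using bij[OF that(1,1)] that(2)
    by (auto simp: \<Psi>_def bij_betw_inv_into_right dest: bij_betwE[OF bij_betw_inv_into])
  \<comment> \<open>Both sides of the first equation lie in
    \<open>hom Y (FObj F A) (FObj G B)\<close>, where \<open>\<Phi> A B\<close> is injective;
    one-sided naturality then moves \<open>\<Phi>\<close> onto \<open>c\<close> and
    \<open>d\<close>.\<close>
  have hom_iff: "FArr G h \<cdot>\<^bsub>Y\<^esub> c = d \<cdot>\<^bsub>Y\<^esub> FArr F h \<longleftrightarrow>
      FArr G' h \<cdot>\<^bsub>Z\<^esub> \<Phi> A A c = \<Phi> B B d \<cdot>\<^bsub>Z\<^esub> FArr F' h"
    if h: "h \<in> hom X A B" and AB: "A \<in> Obj X" "B \<in> Obj X"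
      and c: "c \<in> hom Y (FObj F A) (FObj G A)" and d: "d \<in> hom Y (FObj F B) (FObj G B)"
    for A B c d h
  proof -
    note Y = functor_cat(2)[OF F]
    have "FArr G h \<cdot>\<^bsub>Y\<^esub> c \<in> hom Y (FObj F A) (FObj G B)"
      "d \<cdot>\<^bsub>Y\<^esub> FArr F h \<in> hom Y (FObj F A) (FObj G B)"
      using Comp_hom[OF Y c functor_hom[OF G h]] Comp_hom[OF Y functor_hom[OF F h] d] by auto
    then have "FArr G h \<cdot>\<^bsub>Y\<^esub> c = d \<cdot>\<^bsub>Y\<^esub> FArr F h \<longleftrightarrow>
        \<Phi> A B (FArr G h \<cdot>\<^bsub>Y\<^esub> c) = \<Phi> A B (d \<cdot>\<^bsub>Y\<^esub> FArr F h)"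
      using inj_on_eq_iff[OF bij_betw_imp_inj_on[OF bij[OF AB]]] by blast
    then show ?thesis
      by (simp add: hom_iso_natural_left[OF G G' F iso h d AB(2)]
          hom_iso_natural_right[OF F F' G G' iso h c AB(1)])
  qed
  note cats = is_category_DiAlg[OF F G] is_category_DiAlg[OF F' G']
  have "is_functor (DiAlg X Y F G) (DiAlg X Z F' G') S"
    by (rule is_functorI[OF cats])
      (auto simp: S_def M_def DiAlg_Obj DiAlg_hom DiAlg_sel \<Phi> hom_iff)
  \<comment> \<open>By \<open>hom_iff\<close> and \<open>\<Phi> A A (\<Psi> A c) = c\<close>, the
    equation for the structures \<open>\<Psi> A c\<close> becomes the one already given for
    \<open>c\<close>.\<close>
  moreover have "is_functor (DiAlg X Z F' G') (DiAlg X Y F G) T"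
    by (rule is_functorI[OF cats(2,1)])
      (auto simp: T_def N_def DiAlg_Obj DiAlg_hom DiAlg_sel \<Psi> hom_iff)
  moreover have "func_eq (DiAlg X Y F G) (T \<circ>\<^sub>F S) id_func"
    by (auto simp: func_eq_def comp_func_def id_func_def S_def T_def M_def N_def DiAlg_def \<Phi>)
  moreover have "func_eq (DiAlg X Z F' G') (S \<circ>\<^sub>F T) id_func"
    by (auto simp: func_eq_def comp_func_def id_func_def S_def T_def M_def N_def DiAlg_def \<Psi>)
  ultimately show ?thesis unfolding isomorphic_categories_def by blast
qed


section \<open>Coproducts of left adjoints\<close>

lemma coproduct_ex1:
  assumes "is_coproduct C K A Z" "B \<in> Obj C" "\<And>k. k \<in> K \<Longrightarrow> f k \<in> hom C (A k) B"
  shows "\<exists>!h. h \<in> hom C (apex Z) B \<and> (\<forall>k\<in>K. h \<cdot>\<^bsub>C\<^esub> leg Z k = f k)"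
  using assms unfolding is_coproduct_def by simp

text \<open>The coprojections are jointly epic: both arrows mediate the same cocone, and mediating
  arrows are unique.\<close>

lemma coproduct_hom_eqI:
  assumes "is_category C" "is_coproduct C K A Z" "h \<in> hom C (apex Z) B" "h' \<in> hom C (apex Z) B"
    and "\<And>k. k \<in> K \<Longrightarrow> h \<cdot>\<^bsub>C\<^esub> leg Z k = h' \<cdot>\<^bsub>C\<^esub> leg Z k"
  shows "h = h'"
proof -
  have "h \<cdot>\<^bsub>C\<^esub> leg Z k \<in> hom C (A k) B" if "k \<in> K" for k
    using assms(2) that unfolding is_coproduct_def by (auto intro: Comp_hom[OF assms(1) _ assms(3)])
  note coproduct_ex1[OF assms(2) Obj_hom(2)[OF assms(1,3)] this]
  moreover have "\<forall>k\<in>K. h' \<cdot>\<^bsub>C\<^esub> leg Z k = h \<cdot>\<^bsub>C\<^esub> leg Z k"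
    using assms(5) by simp
  ultimately show ?thesis using assms(3,4) by blast
qed

section \<open>Functoriality of the pointwise coproduct\<close>

text \<open>The choice \<open>cop\<close> is constrained only at extensional families, hence the
  restricted argument \<open>\<lambda>k\<in>K. FObj (H k) A\<close> throughout.\<close>

locale chosen_coproducts =
  fixes X :: "('o1, 'a1) category" and C :: "('o2, 'a2) category" and K :: "'k set"
    and cop :: "('k \<Rightarrow> 'o2) \<Rightarrow> ('k, 'o2, 'a2) cone"
    and H :: "'k \<Rightarrow> ('o1, 'a1, 'o2, 'a2) func"
  assumes X: "is_category X" and C: "is_category C"
    and H: "\<And>k. k \<in> K \<Longrightarrow> is_functor X C (H k)"
    and cop: "\<And>A. A \<in> K \<rightarrow>\<^sub>E Obj C \<Longrightarrow> is_coproduct C K A (cop A)"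
begin

lemma coproduct_func_obj:
  assumes "A \<in> Obj X"
  defines "c \<equiv> cop (\<lambda>k\<in>K. FObj (H k) A)"
  shows "is_coproduct C K (\<lambda>k\<in>K. FObj (H k) A) c"
    and "FObj (coproduct_func X C K cop H) A = apex c"
    and "k \<in> K \<Longrightarrow> leg c k \<in> hom C (FObj (H k) A) (apex c)"
proof -
  show *: "is_coproduct C K (\<lambda>k\<in>K. FObj (H k) A) c"
    unfolding c_def by (rule cop) (auto intro: functor_Obj[OF H] assms(1))
  show "FObj (coproduct_func X C K cop H) A = apex c"
    by (simp add: coproduct_func_def c_def)
  show "leg c k \<in> hom C (FObj (H k) A) (apex c)" if "k \<in> K"
    using * that unfolding is_coproduct_def by auto
qed

text \<open>The definite description in \<open>coproduct_func\<close> denotes the mediating arrow of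
  the cocone formed by the coprojections at \<open>B\<close> composed with
  \<open>FArr (H k) f\<close>; universality makes it well defined.\<close>

lemma coproduct_func_arr:
  assumes f: "f \<in> hom X A B"
  defines "c \<equiv> \<lambda>A. cop (\<lambda>k\<in>K. FObj (H k) A)"
  shows "FArr (coproduct_func X C K cop H) f \<in> hom C (apex (c A)) (apex (c B))"
    and "k \<in> K \<Longrightarrow> FArr (coproduct_func X C K cop H) f \<cdot>\<^bsub>C\<^esub> leg (c A) k =
      leg (c B) k \<cdot>\<^bsub>C\<^esub> FArr (H k) f"
proof -
  note AB = Obj_hom[OF X f]
  have "leg (c B) k \<cdot>\<^bsub>C\<^esub> FArr (H k) f \<in> hom C ((\<lambda>k\<in>K. FObj (H k) A) k) (apex (c B))"
    if "k \<in> K" for k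
    using coproduct_func_obj(3)[OF AB(2) that] functor_hom[OF H[OF that] f] that
    by (auto simp: c_def intro: Comp_hom[OF C])
  moreover have "apex (c B) \<in> Obj C"
    using coproduct_func_obj(1)[OF AB(2)] by (simp add: is_coproduct_def c_def)
  ultimately have "\<exists>!h. h \<in> hom C (apex (c A)) (apex (c B)) \<and>
      (\<forall>k\<in>K. h \<cdot>\<^bsub>C\<^esub> leg (c A) k = leg (c B) k \<cdot>\<^bsub>C\<^esub> FArr (H k) f)"
    unfolding c_def by (intro coproduct_ex1[OF coproduct_func_obj(1)[OF AB(1)]]) auto
  from theI'[OF this] homD[OF f]
  show "FArr (coproduct_func X C K cop H) f \<in> hom C (apex (c A)) (apex (c B))"
    and "k \<in> K \<Longrightarrow> FArr (coproduct_func X C K cop H) f \<cdot>\<^bsub>C\<^esub> leg (c A) k =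
      leg (c B) k \<cdot>\<^bsub>C\<^esub> FArr (H k) f"
    by (simp_all add: coproduct_func_def c_def)
qed

text \<open>The identity and composition laws are checked after precomposing with each coprojection,
  which suffices by joint epicness.\<close>

lemma is_functor_coproduct_func: "is_functor X C (coproduct_func X C K cop H)"
proof (rule is_functorI[OF X C])
  let ?T = "coproduct_func X C K cop H"
  show Obj: "FObj ?T A \<in> Obj C" if "A \<in> Obj X" for A
    using coproduct_func_obj(1,2)[OF that] by (simp add: is_coproduct_def)
  show hom: "FArr ?T f \<in> hom C (FObj ?T A) (FObj ?T B)" if "f \<in> hom X A B" for A B f
    using coproduct_func_arr(1)[OF that] coproduct_func_obj(2) Obj_hom[OF X that] by simp
  show "FArr ?T (Ide X A) = Ide C (FObj ?T A)" if A: "A \<in> Obj X" for A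
  proof (rule coproduct_hom_eqI[OF C coproduct_func_obj(1)[OF A]])
    show "FArr ?T (Ide X A) \<in> hom C (apex (cop (\<lambda>k\<in>K. FObj (H k) A))) (FObj ?T A)"
      "Ide C (FObj ?T A) \<in> hom C (apex (cop (\<lambda>k\<in>K. FObj (H k) A))) (FObj ?T A)"
      using hom[OF Ide_hom[OF X A]] Ide_hom[OF C Obj[OF A]]
      by (simp_all add: coproduct_func_obj(2)[OF A])
    show "FArr ?T (Ide X A) \<cdot>\<^bsub>C\<^esub> leg (cop (\<lambda>k\<in>K. FObj (H k) A)) k =
        Ide C (FObj ?T A) \<cdot>\<^bsub>C\<^esub> leg (cop (\<lambda>k\<in>K. FObj (H k) A)) k" if "k \<in> K" for k
      using coproduct_func_arr(2)[OF Ide_hom[OF X A] that] coproduct_func_obj(3)[OF A that]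
      by (simp add: coproduct_func_obj(2)[OF A] functor_Ide[OF H[OF that] A]
          Comp_Ide_left[OF C] Comp_Ide_right[OF C])
  qed
  show "FArr ?T (g \<cdot>\<^bsub>X\<^esub> f) = FArr ?T g \<cdot>\<^bsub>C\<^esub> FArr ?T f"
    if f: "f \<in> hom X A B" and g: "g \<in> hom X B D" for A B D f g
  proof (rule coproduct_hom_eqI[OF C coproduct_func_obj(1)])
    show A: "A \<in> Obj X" using Obj_hom[OF X f] by simp
    have B: "B \<in> Obj X" and D: "D \<in> Obj X" using Obj_hom[OF X g] by auto
    let ?c = "\<lambda>A. cop (\<lambda>k\<in>K. FObj (H k) A)"
    note gf = Comp_hom[OF X f g]
    show "FArr ?T (g \<cdot>\<^bsub>X\<^esub> f) \<in> hom C (apex (?c A)) (apex (?c D))"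
      by (rule coproduct_func_arr(1)[OF gf])
    note Tf = coproduct_func_arr(1)[OF f] and Tg = coproduct_func_arr(1)[OF g]
    show "FArr ?T g \<cdot>\<^bsub>C\<^esub> FArr ?T f \<in> hom C (apex (?c A)) (apex (?c D))"
      by (rule Comp_hom[OF C Tf Tg])
    fix k assume k: "k \<in> K"
    note lA = coproduct_func_obj(3)[OF A k] and lB = coproduct_func_obj(3)[OF B k]
      and lD = coproduct_func_obj(3)[OF D k]
      and Hf = functor_hom[OF H[OF k] f] and Hg = functor_hom[OF H[OF k] g]
    \<comment> \<open>The coprojection squares of \<open>f\<close> and of \<open>g\<close> are used
      in turn, and functoriality of \<open>H k\<close> merges them into the square of the
      composite.\<close>
    have "(FArr ?T g \<cdot>\<^bsub>C\<^esub> FArr ?T f) \<cdot>\<^bsub>C\<^esub> leg (?c A) k =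
        FArr ?T g \<cdot>\<^bsub>C\<^esub> (leg (?c B) k \<cdot>\<^bsub>C\<^esub> FArr (H k) f)"
      by (simp add: Comp_assoc[OF C lA Tf Tg] coproduct_func_arr(2)[OF f k])
    also have "\<dots> = (leg (?c D) k \<cdot>\<^bsub>C\<^esub> FArr (H k) g) \<cdot>\<^bsub>C\<^esub> FArr (H k) f"
      by (simp add: Comp_assoc[OF C Hf lB Tg, symmetric] coproduct_func_arr(2)[OF g k])
    also have "\<dots> = FArr ?T (g \<cdot>\<^bsub>X\<^esub> f) \<cdot>\<^bsub>C\<^esub> leg (?c A) k"
      by (simp add: Comp_assoc[OF C Hf Hg lD] coproduct_func_arr(2)[OF gf k]
          functor_Comp[OF H[OF k] f g])
    finally show "FArr ?T (g \<cdot>\<^bsub>X\<^esub> f) \<cdot>\<^bsub>C\<^esub> leg (?c A) k =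
        (FArr ?T g \<cdot>\<^bsub>C\<^esub> FArr ?T f) \<cdot>\<^bsub>C\<^esub> leg (?c A) k" by simp
  qed
qed

end

section \<open>Transposing out of a coproduct of left adjoints\<close>

text \<open>Composes two natural bijections: the universal property splits an arrow out of
  \<open>T A\<close> into components, and each component is transposed along the adjunction of
  \<open>L k\<close> and \<open>G k\<close>. The two functoriality claims are side conditions for
  passing from \<open>hom_iso\<close> to dialgebras.\<close>

lemma hom_iso_coproduct_adjoints:
  fixes X :: "('o1, 'a1) category" and Y :: "'k \<Rightarrow> ('o2, 'a2) category"
  assumes X: "is_category X" and F: "is_functor X (prod_cat K Y) F"
    and adj: "\<And>k. k \<in> K \<Longrightarrow> adjunction (Y k) X (L k) (G k)"
    and cop: "\<And>A. A \<in> K \<rightarrow>\<^sub>E Obj X \<Longrightarrow> is_coproduct X K A (cop A)"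
  defines "T \<equiv> coproduct_func X X K cop (\<lambda>k. L k \<circ>\<^sub>F (proj_func k \<circ>\<^sub>F F))"
  shows "is_functor X X T"
    and "is_functor X (prod_cat K Y) (tuple_func K G)"
    and "\<exists>\<Phi>. hom_iso X X T id_func (prod_cat K Y) F (tuple_func K G) \<Phi>"
proof -
  let ?H = "\<lambda>k. L k \<circ>\<^sub>F (proj_func k \<circ>\<^sub>F F)"
  let ?c = "\<lambda>A. cop (\<lambda>k\<in>K. FObj (?H k) A)"
  let ?G = "tuple_func K G"
  let ?Y = "prod_cat K Y"
  have L: "is_functor (Y k) X (L k)" and G: "is_functor X (Y k) (G k)" if "k \<in> K" for k
    using adj[OF that] by (auto simp: adjunction_def)
  have Y: "is_category (Y k)" if "k \<in> K" for k
    using functor_cat[OF L[OF that]] by simp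
  have H: "is_functor X X (?H k)" if "k \<in> K" for k
    using is_functor_comp[OF is_functor_comp[OF F is_functor_proj] L] Y that by blast
  interpret T: chosen_coproducts X X K cop ?H
    using X H cop by unfold_locales
  show "is_functor X ?Y ?G"
    using is_functor_tuple[OF X G] .
  show T: "is_functor X X T"
    unfolding T_def by (rule T.is_functor_coproduct_func)
  note T_obj = T.coproduct_func_obj[folded T_def]
  note T_arr = T.coproduct_func_arr[folded T_def]
  have H_obj: "FObj (?H k) A = FObj (L k) (FObj F A k)"
    and H_arr: "FArr (?H k) f = FArr (L k) (FArr F f k)" for k A f
    by (simp_all add: comp_func_def proj_func_def)
  have "\<forall>k\<in>K. \<exists>\<phi>. (\<forall>A\<in>Obj (Y k). \<forall>B\<in>Obj X.
              bij_betw (\<phi> A B) (hom X (FObj (L k) A) B) (hom (Y k) A (FObj (G k) B))) \<and>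
          (\<forall>A\<in>Obj (Y k). \<forall>A'\<in>Obj (Y k). \<forall>B\<in>Obj X. \<forall>B'\<in>Obj X.
             \<forall>a\<in>hom (Y k) A' A. \<forall>b\<in>hom X B B'. \<forall>f\<in>hom X (FObj (L k) A) B.
               \<phi> A' B' ((b \<cdot>\<^bsub>X\<^esub> f) \<cdot>\<^bsub>X\<^esub> FArr (L k) a) = (FArr (G k) b \<cdot>\<^bsub>Y k\<^esub> \<phi> A B f) \<cdot>\<^bsub>Y k\<^esub> a)"
    using adj unfolding adjunction_def by blast
  \<comment> \<open>Each adjunction asserts only that a transposition exists; one is chosen for all
    \<open>k\<close> simultaneously.\<close>
  from bchoice[OF this] obtain \<phi> where
    \<phi>: "\<forall>k\<in>K. (\<forall>A\<in>Obj (Y k). \<forall>B\<in>Obj X.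
              bij_betw (\<phi> k A B) (hom X (FObj (L k) A) B) (hom (Y k) A (FObj (G k) B))) \<and>
          (\<forall>A\<in>Obj (Y k). \<forall>A'\<in>Obj (Y k). \<forall>B\<in>Obj X. \<forall>B'\<in>Obj X.
             \<forall>a\<in>hom (Y k) A' A. \<forall>b\<in>hom X B B'. \<forall>f\<in>hom X (FObj (L k) A) B.
               \<phi> k A' B' ((b \<cdot>\<^bsub>X\<^esub> f) \<cdot>\<^bsub>X\<^esub> FArr (L k) a) = (FArr (G k) b \<cdot>\<^bsub>Y k\<^esub> \<phi> k A B f) \<cdot>\<^bsub>Y k\<^esub> a)" ..
  then have bij: "bij_betw (\<phi> k A B) (hom X (FObj (L k) A) B) (hom (Y k) A (FObj (G k) B))"
    if "k \<in> K" "A \<in> Obj (Y k)" "B \<in> Obj X" for k A B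
    using that by blast
  have nat: "\<phi> k A' B' ((b \<cdot>\<^bsub>X\<^esub> f) \<cdot>\<^bsub>X\<^esub> FArr (L k) a) = (FArr (G k) b \<cdot>\<^bsub>Y k\<^esub> \<phi> k A B f) \<cdot>\<^bsub>Y k\<^esub> a"
    if k: "k \<in> K" and a: "a \<in> hom (Y k) A' A" and b: "b \<in> hom X B B'"
      and f: "f \<in> hom X (FObj (L k) A) B" for k A A' B B' a b f
    using bspec[OF \<phi> k] Obj_hom[OF Y[OF k] a] Obj_hom[OF X b] a b f by blast
  have F_obj: "FObj F A k \<in> Obj (Y k)" if "A \<in> Obj X" "k \<in> K" for A k
    using functor_Obj[OF F that(1)] that(2) by (auto simp: prod_cat_sel)
  have leg: "leg (?c A) k \<in> hom X (FObj (L k) (FObj F A k)) (FObj T A)"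
    if "A \<in> Obj X" "k \<in> K" for A k
    using T_obj(2)[of A] T_obj(3)[of A k] that by (simp add: H_obj)
  have homY: "f \<in> hom ?Y (FObj F A) (FObj ?G B) \<longleftrightarrow>
      f \<in> extensional K \<and> (\<forall>k\<in>K. f k \<in> hom (Y k) (FObj F A k) (FObj (G k) B))"
    if "A \<in> Obj X" for A B f
    using functor_Obj[OF F that]
    by (subst hom_prod_cat) (auto simp: prod_cat_sel PiE_iff tuple_func_def)
  \<comment> \<open>The \<open>k\<close>-th entry is the transpose of the \<open>k\<close>-th
    component; outside \<open>K\<close> the value is the default, as arrows of
    \<open>prod_cat\<close> are extensional.\<close>
  define \<Phi> where "\<Phi> A B t = (\<lambda>k\<in>K. \<phi> k (FObj F A k) B (t \<cdot>\<^bsub>X\<^esub> leg (?c A) k))" for A B t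
  have "bij_betw (\<Phi> A B) (hom X (FObj T A) B) (hom ?Y (FObj F A) (FObj ?G B))"
    if A: "A \<in> Obj X" and B: "B \<in> Obj X" for A B
  proof (rule bij_betw_imageI)
    have tl: "t \<cdot>\<^bsub>X\<^esub> leg (?c A) k \<in> hom X (FObj (L k) (FObj F A k)) B"
      if "t \<in> hom X (FObj T A) B" "k \<in> K" for t k
      using Comp_hom[OF X leg[OF A that(2)] that(1)] .
    show "inj_on (\<Phi> A B) (hom X (FObj T A) B)"
    proof (rule inj_onI)
      fix t t' assume t: "t \<in> hom X (FObj T A) B" and t': "t' \<in> hom X (FObj T A) B"
        and eq: "\<Phi> A B t = \<Phi> A B t'"
      \<comment> \<open>Equal transposes come from equal components, by injectivity of
        \<open>\<phi> k\<close>; the components determine the arrow.\<close>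
      have "t \<cdot>\<^bsub>X\<^esub> leg (?c A) k = t' \<cdot>\<^bsub>X\<^esub> leg (?c A) k" if k: "k \<in> K" for k
        using inj_onD[OF bij_betw_imp_inj_on[OF bij[OF k F_obj[OF A k] B]] _ tl[OF t k] tl[OF t' k]]
          fun_cong[OF eq, of k] k by (simp add: \<Phi>_def)
      then show "t = t'"
        using coproduct_hom_eqI[OF X T_obj(1)[OF A] t[unfolded T_obj(2)[OF A]] t'[unfolded T_obj(2)[OF A]]]
        by blast
    qed
    show "\<Phi> A B ` hom X (FObj T A) B = hom ?Y (FObj F A) (FObj ?G B)"
    proof (rule equalityI; rule subsetI)
      fix g assume "g \<in> \<Phi> A B ` hom X (FObj T A) B"
      then obtain t where t: "t \<in> hom X (FObj T A) B" and g: "g = \<Phi> A B t" by blast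
      have "\<phi> k (FObj F A k) B (t \<cdot>\<^bsub>X\<^esub> leg (?c A) k) \<in> hom (Y k) (FObj F A k) (FObj (G k) B)"
        if "k \<in> K" for k
        using bspec[OF bij_betwE[OF bij[OF that F_obj[OF A that] B]] tl[OF t that]] .
      then show "g \<in> hom ?Y (FObj F A) (FObj ?G B)"
        by (simp add: homY[OF A] g \<Phi>_def)
    next
      fix g assume g: "g \<in> hom ?Y (FObj F A) (FObj ?G B)"
      \<comment> \<open>For surjectivity, each entry of \<open>g\<close> is transposed back to a
        component \<open>f k\<close>, and the components are glued to an arrow \<open>t\<close> out
        of the coproduct.\<close>
      define f where
        "f k = inv_into (hom X (FObj (L k) (FObj F A k)) B) (\<phi> k (FObj F A k) B) (g k)" for k
      have f: "f k \<in> hom X (FObj (L k) (FObj F A k)) B" "\<phi> k (FObj F A k) B (f k) = g k"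
        if k: "k \<in> K" for k
      proof -
        note bij_k = bij[OF k F_obj[OF A k] B]
        have gk: "g k \<in> hom (Y k) (FObj F A k) (FObj (G k) B)"
          using g k by (simp add: homY[OF A])
        show "f k \<in> hom X (FObj (L k) (FObj F A k)) B"
          unfolding f_def using bspec[OF bij_betwE[OF bij_betw_inv_into[OF bij_k]] gk] .
        show "\<phi> k (FObj F A k) B (f k) = g k"
          unfolding f_def using bij_betw_inv_into_right[OF bij_k gk] .
      qed
      have "\<exists>!t. t \<in> hom X (apex (?c A)) B \<and> (\<forall>k\<in>K. t \<cdot>\<^bsub>X\<^esub> leg (?c A) k = f k)"
        by (rule coproduct_ex1[OF T_obj(1)[OF A] B]) (simp add: f(1) H_obj)
      then obtain t where t: "t \<in> hom X (apex (?c A)) B" "\<forall>k\<in>K. t \<cdot>\<^bsub>X\<^esub> leg (?c A) k = f k"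
        by blast
      have "g \<in> extensional K"
        using g by (simp add: homY[OF A])
      then have "g = \<Phi> A B t"
        using t(2) f(2) by (intro extensionalityI[of _ K]) (simp_all add: \<Phi>_def)
      then show "g \<in> \<Phi> A B ` hom X (FObj T A) B"
        using t(1)[folded T_obj(2)[OF A]] by (rule image_eqI)
    qed
  qed
  moreover have "\<Phi> A' B' ((b \<cdot>\<^bsub>X\<^esub> t) \<cdot>\<^bsub>X\<^esub> FArr T a) = (FArr ?G b \<cdot>\<^bsub>?Y\<^esub> \<Phi> A B t) \<cdot>\<^bsub>?Y\<^esub> FArr F a"
    if a: "a \<in> hom X A' A" and b: "b \<in> hom X B B'" and t: "t \<in> hom X (FObj T A) B"
    for A A' B B' a b t
  proof -
    note A' = Obj_hom(1)[OF X a] and A = Obj_hom(2)[OF X a]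
    have "\<phi> k (FObj F A' k) B' (((b \<cdot>\<^bsub>X\<^esub> t) \<cdot>\<^bsub>X\<^esub> FArr T a) \<cdot>\<^bsub>X\<^esub> leg (?c A') k) =
        (FArr (G k) b \<cdot>\<^bsub>Y k\<^esub> \<phi> k (FObj F A k) B (t \<cdot>\<^bsub>X\<^esub> leg (?c A) k)) \<cdot>\<^bsub>Y k\<^esub> FArr F a k"
      if k: "k \<in> K" for k
    proof -
      have Fa: "FArr F a k \<in> hom (Y k) (FObj F A' k) (FObj F A k)"
        using hom_prod_cat_app[OF functor_hom[OF F a] k] .
      note LFa = functor_hom[OF L[OF k] Fa]
      note l = leg[OF A k] and l' = leg[OF A' k]
      note bt = Comp_hom[OF X t b] and tl = Comp_hom[OF X l t]
      \<comment> \<open>Naturality of the coprojection moves it past \<open>FArr T a\<close>,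
        leaving the component of \<open>t\<close> between \<open>b\<close> and
        \<open>FArr (L k) (FArr F a k)\<close>, the form to which \<open>nat\<close>
        applies.\<close>
      have "((b \<cdot>\<^bsub>X\<^esub> t) \<cdot>\<^bsub>X\<^esub> FArr T a) \<cdot>\<^bsub>X\<^esub> leg (?c A') k =
          (b \<cdot>\<^bsub>X\<^esub> t) \<cdot>\<^bsub>X\<^esub> (leg (?c A) k \<cdot>\<^bsub>X\<^esub> FArr (L k) (FArr F a k))"
        using T_arr(2)[OF a k]
        by (simp add: Comp_assoc[OF X l' functor_hom[OF T a] bt] H_arr)
      also have "\<dots> = (b \<cdot>\<^bsub>X\<^esub> (t \<cdot>\<^bsub>X\<^esub> leg (?c A) k)) \<cdot>\<^bsub>X\<^esub> FArr (L k) (FArr F a k)"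
        by (simp add: Comp_assoc[OF X LFa l bt, symmetric] Comp_assoc[OF X l t b])
      finally show ?thesis using nat[OF k Fa b tl] by simp
    qed
    then show ?thesis
      unfolding \<Phi>_def prod_cat_sel tuple_func_def by (intro restrict_ext) simp
  qed
  ultimately show "\<exists>\<Phi>. hom_iso X X T id_func ?Y F ?G \<Phi>"
    unfolding hom_iso_def by (intro exI[of _ \<Phi>]) (simp add: id_func_def)
qed

section \<open>Dialgebras as algebras and as coalgebras\<close>

text \<open>An algebra is a dialgebra with the identity as target functor, so the natural bijection
  just constructed relates the two categories. The setting is an arbitrary family of adjunctions
  into \<open>X\<close>; fibres enter only on instantiation.\<close>

theorem isomorphic_DiAlg_Alg:
  assumes X: "is_category X" and F: "is_functor X (prod_cat K Y) F"
    and adj: "\<And>k. k \<in> K \<Longrightarrow> adjunction (Y k) X (L k) (G k)"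
    and cop: "\<And>A. A \<in> K \<rightarrow>\<^sub>E Obj X \<Longrightarrow> is_coproduct X K A (cop A)"
  shows "isomorphic_categories (DiAlg X (prod_cat K Y) F (tuple_func K G))
    (Alg X (coproduct_func X X K cop (\<lambda>k. L k \<circ>\<^sub>F (proj_func k \<circ>\<^sub>F F))))"
proof -
  let ?T = "coproduct_func X X K cop (\<lambda>k. L k \<circ>\<^sub>F (proj_func k \<circ>\<^sub>F F))"
  have T: "is_functor X X ?T" and G: "is_functor X (prod_cat K Y) (tuple_func K G)"
    and "\<exists>\<Phi>. hom_iso X X ?T id_func (prod_cat K Y) F (tuple_func K G) \<Phi>"
    by (rule hom_iso_coproduct_adjoints[OF X F adj cop]; assumption)+
  then obtain \<Phi> where "hom_iso X X ?T id_func (prod_cat K Y) F (tuple_func K G) \<Phi>" by blast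
  from isomorphic_DiAlg[OF T is_functor_id[OF X] F G this] show ?thesis
    unfolding Alg_def by (rule isomorphic_categories_sym)
qed

text \<open>Passing to \<open>op_cat X\<close> and \<open>op_cat (Y k)\<close> makes each
  \<open>R k\<close> a left adjoint of \<open>G k\<close> and turns the chosen products into
  coproducts, so the natural bijection is available there and is carried back.\<close>

theorem isomorphic_DiAlg_CoAlg:
  assumes X: "is_category X" and F: "is_functor X (prod_cat K Y) F"
    and adj: "\<And>k. k \<in> K \<Longrightarrow> adjunction X (Y k) (G k) (R k)"
    and prd: "\<And>A. A \<in> K \<rightarrow>\<^sub>E Obj X \<Longrightarrow> is_product X K A (prd A)"
  shows "isomorphic_categories (DiAlg X (prod_cat K Y) (tuple_func K G) F)
    (CoAlg X (product_func X X K prd (\<lambda>k. R k \<circ>\<^sub>F (proj_func k \<circ>\<^sub>F F))))"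
proof -
  let ?T = "product_func X X K prd (\<lambda>k. R k \<circ>\<^sub>F (proj_func k \<circ>\<^sub>F F))"
  have cop: "is_coproduct (op_cat X) K A (prd A)" if "A \<in> K \<rightarrow>\<^sub>E Obj (op_cat X)" for A
    using prd that by (simp add: is_coproduct_op)
  \<comment> \<open>The product of opposites is refolded into the opposite of the product, and the
    coproduct functor is read as \<open>product_func\<close>.\<close>
  note * = hom_iso_coproduct_adjoints[where Y = "\<lambda>k. op_cat (Y k)" and X = "op_cat X",
      unfolded coproduct_func_op op_prod_cat[symmetric],
      OF is_category_op[OF X] is_functor_op[OF F] adjunction_op[OF adj] cop]
  have T': "is_functor (op_cat X) (op_cat X) ?T"
    and G': "is_functor (op_cat X) (op_cat (prod_cat K Y)) (tuple_func K G)"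
    and "\<exists>\<Phi>. hom_iso (op_cat X) (op_cat X) ?T id_func (op_cat (prod_cat K Y)) F (tuple_func K G) \<Phi>"
    by (rule *; assumption)+
  then obtain \<Phi> where \<Phi>:
    "hom_iso (op_cat X) (op_cat X) ?T id_func (op_cat (prod_cat K Y)) F (tuple_func K G) \<Phi>"
    by blast
  have T: "is_functor X X ?T" and G: "is_functor X (prod_cat K Y) (tuple_func K G)"
    using is_functor_op[OF T'] is_functor_op[OF G'] by simp_all
  \<comment> \<open>Reversal puts \<open>id_func\<close> and the tuple in source position:
    dialgebras from the identity to the product functor, that is, coalgebras.\<close>
  note hom_iso_op[OF T is_functor_id[OF X] F G \<Phi>]
  from isomorphic_DiAlg[OF is_functor_id[OF X] T G F this] show ?thesis
    unfolding CoAlg_def by (rule isomorphic_categories_sym)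
qed

theorem theorem4p1:
  fixes P :: "('e, 'f, 'b, 'c) fibration"
    and I :: 'b and n :: nat and J :: "nat \<Rightarrow> 'b"
    and F :: "('e, 'f, nat \<Rightarrow> 'e, nat \<Rightarrow> 'f) func"
    and u :: "nat \<Rightarrow> 'c"
  assumes "is_cloven_fibration P"
    and "I \<in> Obj (Base P)"
    and "\<And>k. k \<in> {1..n} \<Longrightarrow> J k \<in> Obj (Base P)"
    and "is_functor (fibre P I) (fibre_prod P n J) F"
    and "\<And>k. k \<in> {1..n} \<Longrightarrow> u k \<in> hom (Base P) (J k) I"
  shows
    "(\<forall>cop S. fibrewise_coproducts P cop \<and> dependent_sums P S \<longrightarrow>
        isomorphic_categories
          (DiAlg (fibre P I) (fibre_prod P n J) F (reindex_tuple P n u))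
          (Alg (fibre P I) (sum_endofunctor P cop S I n F u)) \<and>
        ((\<exists>X. is_inductive_data_type P I n J F u X) \<longleftrightarrow>
         (\<exists>X. is_initial (Alg (fibre P I) (sum_endofunctor P cop S I n F u)) X)))
     \<and>
     (\<forall>prd R. fibrewise_products P prd \<and> dependent_products P R \<longrightarrow>
        isomorphic_categories
          (DiAlg (fibre P I) (fibre_prod P n J) (reindex_tuple P n u) F)
          (CoAlg (fibre P I) (product_endofunctor P prd R I n F u)) \<and>
        ((\<exists>X. is_coinductive_data_type P I n J F u X) \<longleftrightarrow>
         (\<exists>X. is_final (CoAlg (fibre P I) (product_endofunctor P prd R I n F u)) X)))"
proof -
  let ?X = "fibre P I" and ?Y = "\<lambda>k. fibre P (J k)" and ?K = "{1..n}"
  note F = assms(4)[unfolded fibre_prod_def]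
  note X = functor_cat(1)[OF F]
  \<comment> \<open>The typing of \<open>u k\<close> makes \<open>reindex P (u k)\<close> run from
    the fibre over \<open>I\<close> to the fibre over \<open>J k\<close>, so its adjunctions have
    the shape required by the general results.\<close>
  have u: "u k \<in> Arr (Base P)" "Dom (Base P) (u k) = J k" "Cod (Base P) (u k) = I"
    if "k \<in> ?K" for k
    using homD[OF assms(5)[OF that]] by simp_all
  have sums: "isomorphic_categories
      (DiAlg ?X (fibre_prod P n J) F (reindex_tuple P n u)) (Alg ?X (sum_endofunctor P cop S I n F u))"
    if "fibrewise_coproducts P cop" "dependent_sums P S" for cop S
    unfolding fibre_prod_def reindex_tuple_def sum_endofunctor_def component_def
  proof (rule isomorphic_DiAlg_Alg[OF X F])
    show "adjunction (?Y k) ?X (S (u k)) (reindex P (u k))" if "k \<in> ?K" for k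
      using \<open>dependent_sums P S\<close> u[OF that] by (auto simp: dependent_sums_def)
    show "is_coproduct ?X ?K A (cop I n A)" if "A \<in> ?K \<rightarrow>\<^sub>E Obj ?X" for A
      using \<open>fibrewise_coproducts P cop\<close> assms(2) that by (auto simp: fibrewise_coproducts_def)
  qed
  have prods: "isomorphic_categories
      (DiAlg ?X (fibre_prod P n J) (reindex_tuple P n u) F) (CoAlg ?X (product_endofunctor P prd R I n F u))"
    if "fibrewise_products P prd" "dependent_products P R" for prd R
    unfolding fibre_prod_def reindex_tuple_def product_endofunctor_def component_def
  proof (rule isomorphic_DiAlg_CoAlg[OF X F])
    show "adjunction ?X (?Y k) (reindex P (u k)) (R (u k))" if "k \<in> ?K" for k
      using \<open>dependent_products P R\<close> u[OF that] by (auto simp: dependent_products_def)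
    show "is_product ?X ?K A (prd I n A)" if "A \<in> ?K \<rightarrow>\<^sub>E Obj ?X" for A
      using \<open>fibrewise_products P prd\<close> assms(2) that by (auto simp: fibrewise_products_def)
  qed
  \<comment> \<open>The existence equivalences follow since an isomorphism of categories transports
    initial and final objects.\<close>
  show ?thesis
    unfolding is_inductive_data_type_def is_coinductive_data_type_def
    by (intro conjI allI impI; elim conjE)
      (rule sums prods isomorphic_categories_initial_iff[OF sums]
         isomorphic_categories_final_iff[OF prods]; assumption)+
qed

end
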